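(* Let $s^\star = s^\star_n$ be a sequence such that $s^\star\log(p/s^\star) = o(n)$ as $n\to\infty$, and set $\varepsilon_n^2 = n^{-1}s^\star\log(p/s^\star)$. For a given $\tilde x \in \mathbb{R}^p$, let $f^\star_{\tilde x}(\tilde y) = \mathsf{N}(\tilde y \mid \tilde x^\top\beta^\star, \sigma^2)$ denote the true density of the new observation, let $f^n_{\tilde x}$ denote the empirical Bayes predictive density (defined in the context), and let $H(f^\star_{\tilde x}, f^n_{\tilde x})$ denote the Hellinger distance between them. Then $$\sup_{\beta^\star\in\mathbb{R}^p:\,|S_{\beta^\star}| = s^\star} \mathsf{E}_{\beta^\star} \int H^2(f^\star_{\tilde x}, f^n_{\tilde x})\, Q_n(d\tilde x) \lesssim \varepsilon_n^2,$$ where $Q_n$ is the empirical distribution of the $n$ rows of $X$.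
   Context: Model: $y = X\beta + \sigma z$, with $y \in \mathbb{R}^n$, $X$ a (non-random) $n \times p$ matrix, $z$ a vector of $n$ independent standard normals, and $\sigma^2 > 0$ known. Asymptotics are as $n\to\infty$, with $p = p_n \ge n$ and $X = X_n$ depending on $n$; the rank $R$ of $X$ equals $n$. $\mathsf{E}_{\beta^\star}$ is expectation over $y \sim \mathsf{N}_n(X\beta^\star, \sigma^2 I)$. For $\beta\in\mathbb{R}^p$, $S_\beta = \{j : \beta_j \neq 0\}$, and $|S|$ is the cardinality of $S$. The sparsity level $s^\star$ is a positive integer. The symbol $\lesssim$ means inequality up to a constant factor not depending on $n$ or $\beta^\star$. Empirical prior: for $S \subseteq \{1,\dots,p\}$ with $|S| \le R$, $\pi(S) = \binom{p}{|S|}^{-1} q_n(|S|)$, where $q_n$ is the probability mass function on $\{0,1,\dots,R\}$ with $q_n(s) \propto (c p^a)^{-s}$, and $a, c > 0$ are fixed constants. Let $X_S$ be the $n \times |S|$ submatrix of $X$ with columns indexed by $S$ ($X_S^\top X_S$ is taken to be invertible for the $S$ supported by the prior) and $\hat\beta_S = (X_S^\top X_S)^{-1} X_S^\top y$ the least squares estimator. Fix constants $\gamma > 0$ and $\alpha \in (0,1)$. The prior is $$\Pi_n(d\beta) = \sum_S \pi(S)\, \mathsf{N}_{|S|}\bigl(d\beta_S \mid \hat\beta_S, \sigma^2\gamma^{-1}(X_S^\top X_S)^{-1}\bigr) \otimes \delta_{0_{S^c}}(d\beta_{S^c}),$$ where $\delta_{0_{S^c}}$ is the point mass at the origin for the coordinates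 in $S^c$. Empirical Bayes posterior: $\Pi^n(d\beta) \propto L_n(\beta)^\alpha\, \Pi_n(d\beta)$, with $L_n(\beta) = \mathsf{N}_n(y \mid X\beta, \sigma^2 I) \propto \exp\{-\|y - X\beta\|^2/(2\sigma^2)\}$. The marginal posterior of $S$ is $$\pi^n(S) \propto \pi(S)\bigl(\tfrac{\gamma}{\alpha+\gamma}\bigr)^{|S|/2}\exp\{-\tfrac{\alpha}{2\sigma^2}\|y - X_S\hat\beta_S\|^2\}.$$ Predictive density at $\tilde x\in\mathbb{R}^p$ (with $\tilde x_S$ the subvector indexed by $S$): $$f^n_{\tilde x}(\tilde y) = \int \mathsf{N}(\tilde y\mid\tilde x^\top\beta,\sigma^2)\,\Pi^n(d\beta) = \sum_S \pi^n(S)\, \mathsf{N}\bigl(\tilde y \mid \tilde x_S^\top\hat\beta_S,\ \sigma^2 + \tfrac{\sigma^2}{\alpha+\gamma}\tilde x_S^\top (X_S^\top X_S)^{-1}\tilde x_S\bigr).$$ The Hellinger distance between densities $f,g$ is $H(f,g)=\{\int (\sqrt{f}-\sqrt{g})^2\}^{1/2}$.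
   Formalization: Adds the assumption log p = O(log(p/s* )); without it the claim fails, e.g. for s* = p = n (ε_n = 0 but positive risk), or p = n, X orthogonal, s* ≈ n/log n, where the posterior can concentrate on the empty model. *)

theory Defs
  imports
    "HOL-Probability.Probability"
    "HOL-Library.Landau_Symbols"
    "Jordan_Normal_Form.Gauss_Jordan_Elimination"
    "Jordan_Normal_Form.DL_Rank"
    "Jordan_Normal_Form.DL_Submatrix"
begin

text \<open>The dimensions vary with the sample size, so vectors and matrices are those of
  Jordan_Normal_Form, with indices starting at 0. The type of such vectors contains vectors of
  every length; the next measure is Lebesgue measure on those of length \<open>k\<close>, transported
  along the bijection \<open>vec k\<close> from the extensional functions on \<open>{..<k}\<close>.\<close>

definition lborel_vec :: "nat \<Rightarrow> real Matrix.vec measure" where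
  "lborel_vec k = embed_measure (\<Pi>\<^sub>M i\<in>{..<k}. lborel) (Matrix.vec k)"

definition mvn_density :: "real Matrix.vec \<Rightarrow> real Matrix.mat \<Rightarrow> real Matrix.vec \<Rightarrow> real" where
  "mvn_density m V x =
     exp (- scalar_prod (x - m) (the (mat_inverse V) *\<^sub>v (x - m)) / 2)
       / sqrt ((2 * pi) ^ dim_vec m * Determinant.det V)"

definition mvn :: "real Matrix.vec \<Rightarrow> real Matrix.mat \<Rightarrow> real Matrix.vec measure" where
  "mvn m V = density (lborel_vec (dim_vec m)) (\<lambda>x. ennreal (mvn_density m V x))"

definition support_vec :: "real Matrix.vec \<Rightarrow> nat set" where
  "support_vec b = {j. j < dim_vec b \<and> b $ j \<noteq> 0}"

definition columns_mat :: "real Matrix.mat \<Rightarrow> nat set \<Rightarrow> real Matrix.mat" where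
  "columns_mat X S = submatrix X UNIV S"

definition gram_mat :: "real Matrix.mat \<Rightarrow> nat set \<Rightarrow> real Matrix.mat" where
  "gram_mat X S = transpose_mat (columns_mat X S) * columns_mat X S"

definition least_squares :: "real Matrix.mat \<Rightarrow> real Matrix.vec \<Rightarrow> nat set \<Rightarrow> real Matrix.vec" where
  "least_squares X y S =
     the (mat_inverse (gram_mat X S)) *\<^sub>v (transpose_mat (columns_mat X S) *\<^sub>v y)"

text \<open>Insertion of a vector of length \<open>card S\<close> into length \<open>p\<close>, with zeros off \<open>S\<close>. The element
  \<open>j\<close> of \<open>S\<close> is the one at position \<open>card {i \<in> S. i < j}\<close> in the increasing enumeration used by
  \<open>submatrix\<close>. The image of a measure under this map is its product with the point mass at the
  origin in the coordinates outside \<open>S\<close>.\<close>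

definition insert_zeros :: "nat \<Rightarrow> nat set \<Rightarrow> real Matrix.vec \<Rightarrow> real Matrix.vec" where
  "insert_zeros p S b =
     Matrix.vec p (\<lambda>j. if j \<in> S then b $ card {i \<in> S. i < j} else 0)"

definition mat_rank :: "real Matrix.mat \<Rightarrow> nat" where
  "mat_rank X = vec_space.rank (dim_row X) X"

definition models :: "real Matrix.mat \<Rightarrow> nat set set" where
  "models X = {S. S \<subseteq> {..<dim_col X} \<and> card S \<le> mat_rank X}"

definition size_prior :: "real \<Rightarrow> real \<Rightarrow> real Matrix.mat \<Rightarrow> nat \<Rightarrow> real" where
  "size_prior a c X k =
     inverse ((c * real (dim_col X) powr a) ^ k)
       / (\<Sum>l\<le>mat_rank X. inverse ((c * real (dim_col X) powr a) ^ l))"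

definition model_prior :: "real \<Rightarrow> real \<Rightarrow> real Matrix.mat \<Rightarrow> nat set \<Rightarrow> real" where
  "model_prior a c X S = size_prior a c X (card S) / real (dim_col X choose card S)"

definition conditional_prior ::
  "real \<Rightarrow> real \<Rightarrow> real Matrix.mat \<Rightarrow> real Matrix.vec \<Rightarrow> nat set \<Rightarrow> real Matrix.vec measure" where
  "conditional_prior \<sigma> \<gamma> X y S =
     distr (mvn (least_squares X y S) ((\<sigma>\<^sup>2 / \<gamma>) \<cdot>\<^sub>m the (mat_inverse (gram_mat X S))))
       (lborel_vec (dim_col X)) (insert_zeros (dim_col X) S)"

definition empirical_prior ::
  "real \<Rightarrow> real \<Rightarrow> real \<Rightarrow> real \<Rightarrow> real Matrix.mat \<Rightarrow> real Matrix.vec \<Rightarrow> real Matrix.vec measure" where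
  "empirical_prior \<sigma> a c \<gamma> X y =
     Giry_Monad.bind (point_measure (models X) (\<lambda>S. ennreal (model_prior a c X S)))
       (conditional_prior \<sigma> \<gamma> X y)"

definition likelihood ::
  "real \<Rightarrow> real Matrix.mat \<Rightarrow> real Matrix.vec \<Rightarrow> real Matrix.vec \<Rightarrow> real" where
  "likelihood \<sigma> X y \<beta> = mvn_density (X *\<^sub>v \<beta>) (\<sigma>\<^sup>2 \<cdot>\<^sub>m 1\<^sub>m (dim_row X)) y"

definition eb_posterior ::
  "real \<Rightarrow> real \<Rightarrow> real \<Rightarrow> real \<Rightarrow> real \<Rightarrow> real Matrix.mat \<Rightarrow> real Matrix.vec \<Rightarrow> real Matrix.vec measure" where
  "eb_posterior \<sigma> a c \<gamma> \<alpha> X y =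
     density (empirical_prior \<sigma> a c \<gamma> X y)
       (\<lambda>\<beta>. ennreal (likelihood \<sigma> X y \<beta> powr \<alpha>
          / (\<integral>b. likelihood \<sigma> X y b powr \<alpha> \<partial>empirical_prior \<sigma> a c \<gamma> X y)))"

definition predictive_density ::
  "real \<Rightarrow> real \<Rightarrow> real \<Rightarrow> real \<Rightarrow> real \<Rightarrow> real Matrix.mat \<Rightarrow> real Matrix.vec
     \<Rightarrow> real Matrix.vec \<Rightarrow> real \<Rightarrow> real" where
  "predictive_density \<sigma> a c \<gamma> \<alpha> X y x t =
     (\<integral>\<beta>. normal_density (scalar_prod x \<beta>) \<sigma> t \<partial>eb_posterior \<sigma> a c \<gamma> \<alpha> X y)"

definition true_density ::
  "real \<Rightarrow> real Matrix.vec \<Rightarrow> real Matrix.vec \<Rightarrow> real \<Rightarrow> real" where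
  "true_density \<sigma> \<beta> x t = normal_density (scalar_prod x \<beta>) \<sigma> t"

definition hellinger :: "(real \<Rightarrow> real) \<Rightarrow> (real \<Rightarrow> real) \<Rightarrow> real" where
  "hellinger f g = sqrt (\<integral>t. (sqrt (f t) - sqrt (g t))\<^sup>2 \<partial>lborel)"

definition empirical_rows :: "real Matrix.mat \<Rightarrow> real Matrix.vec pmf" where
  "empirical_rows X = map_pmf (Matrix.row X) (pmf_of_set {..<dim_row X})"

definition data_law ::
  "real \<Rightarrow> real Matrix.mat \<Rightarrow> real Matrix.vec \<Rightarrow> real Matrix.vec measure" where
  "data_law \<sigma> X \<beta> = mvn (X *\<^sub>v \<beta>) (\<sigma>\<^sup>2 \<cdot>\<^sub>m 1\<^sub>m (dim_row X))"

definition rate_sq :: "(nat \<Rightarrow> nat) \<Rightarrow> (nat \<Rightarrow> nat) \<Rightarrow> nat \<Rightarrow> real" where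
  "rate_sq p s n = real (s n) * ln (real (p n) / real (s n)) / real n"

end

theory Submission
  imports Defs "HOL-Real_Asymp.Real_Asymp"
begin

text \<open>By convexity of the squared Hellinger distance, and since two normal densities with variance
  \<open>\<sigma>\<^sup>2\<close> are at squared distance at most \<open>(m\<^sub>1 - m\<^sub>2)\<^sup>2 / (4 \<sigma>\<^sup>2)\<close>, the risk is at most the expected
  posterior mean of \<open>\<parallel>X (\<beta> - \<beta>\<^sup>\<star>)\<parallel>\<^sup>2 / (4 n \<sigma>\<^sup>2)\<close>. For \<open>g = \<parallel>X (\<beta> - \<beta>\<^sup>\<star>)\<parallel>\<^sup>2 / \<sigma>\<^sup>2\<close> and any \<open>T\<close> and
  \<open>\<eta> > 0\<close> one has \<open>g \<le> T + exp (\<eta> (g - T)) / \<eta>\<close>, so it suffices to control an exponential moment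
  of \<open>g\<close> under the posterior. The denominator of the posterior is bounded below by the term of the
  true model. In the numerator, the term of \<open>S\<close> involves the noise \<open>z\<close> through \<open>\<parallel>P\<^sub>S z\<parallel>\<^sup>2\<close> and through
  its inner product with the bias \<open>(I - P\<^sub>S) X \<beta>\<^sup>\<star>\<close>; because \<open>\<alpha> < 1\<close>, the expectation over \<open>z\<close> is at
  most \<open>K\<^bsup>|S|\<^esup>\<close> for a constant \<open>K\<close>. The prior penalty \<open>(c p\<^sup>a)\<^bsup>-|S|\<^esup>\<close> makes the sum over \<open>S\<close> a convergent
  geometric series times the inverse prior weight of the true model, whose logarithm is of order
  \<open>s\<^sup>\<star> log p\<close>; this is the right choice of \<open>\<eta> T\<close>. Finally, \<open>log p\<close> is of order \<open>log (p / s\<^sup>\<star>)\<close>.\<close>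

subsection \<open>Lebesgue measure on vectors\<close>

text \<open>The prior is centred at least squares estimators and so depends on the data. For each
  fixed \<open>y\<close> the integral over the coefficients of a model is therefore evaluated or
  bounded after a Pythagorean split, and the noise is averaged last. The slack that drives the proof
  is \<alpha> (1 - \<alpha>). A bias m of a model costs the factor exp (- \<alpha> |m|^2 / (2
  \<sigma>^2)), while averaging the inner product of m with the noise gives back exp (\<alpha>^2
  |m|^2 / (2 \<sigma>^2)). The exponential moment spends a further 4 \<eta>: rewriting \<eta> /
  \<sigma>^2 over 2 \<sigma>^2 doubles it, and splitting off the prior fluctuation by |u + v|^2
  \<le> 2 |u|^2 + 2 |v|^2 doubles it again. Hence the condition 4 \<eta> \<le> \<alpha> (1 -
  \<alpha>). At equality the projected noise has exponent 1 - (1 - \<alpha>)^2 over 2 \<sigma>^2, so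
  K = 1 / (1 - \<alpha>). Measurability of the risk in \<open>y\<close> is never established. The
  nonnegative integral is monotone for arbitrary integrands, so it is enough that the final majorant
  is measurable.\<close>

lemma inj_on_vec_space: "inj_on (Matrix.vec k) (space (\<Pi>\<^sub>M i\<in>{..<k}. (lborel :: real measure)))"
proof (rule inj_onI)
  fix x y :: "nat \<Rightarrow> real"
  assume x: "x \<in> space (\<Pi>\<^sub>M i\<in>{..<k}. lborel)" and y: "y \<in> space (\<Pi>\<^sub>M i\<in>{..<k}. lborel)"
    and eq: "Matrix.vec k x = Matrix.vec k y"
  have "x i = y i" if "i < k" for i
    using arg_cong[OF eq, of "\<lambda>v. vec_index v i"] that by simp
  with x y show "x = y"
    by (intro PiE_ext[of x "{..<k}" "\<lambda>_. UNIV"]) (auto simp: space_PiM)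
qed

lemma space_lborel_vec: "space (lborel_vec k) = carrier_vec k"
proof -
  have "v \<in> Matrix.vec k ` ({..<k} \<rightarrow>\<^sub>E UNIV)" if "v \<in> carrier_vec k" for v :: "real Matrix.vec"
    using that by (intro image_eqI[of _ _ "restrict (vec_index v) {..<k}"]) auto
  then show ?thesis
    by (auto simp: lborel_vec_def space_embed_measure space_PiM)
qed

lemma measurable_lborel_vec1:
  "(\<lambda>x. f (Matrix.vec k x)) \<in> measurable (\<Pi>\<^sub>M i\<in>{..<k}. lborel) N \<Longrightarrow> f \<in> measurable (lborel_vec k) N"
  unfolding lborel_vec_def by (rule measurable_embed_measure1)

lemma measurable_vec_lborel: "Matrix.vec k \<in> measurable (\<Pi>\<^sub>M i\<in>{..<k}. lborel) (lborel_vec k)"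
  unfolding lborel_vec_def by (rule measurable_embed_measure2'[OF inj_on_vec_space])

lemma measurable_vec_index:
  assumes f: "f \<in> measurable M (lborel_vec k)" and i: "i < k"
  shows "(\<lambda>x. vec_index (f x) i) \<in> borel_measurable M"
proof -
  have "(\<lambda>v. vec_index v i) \<in> borel_measurable (lborel_vec k)"
    by (rule measurable_lborel_vec1) (simp add: i)
  from measurable_compose[OF f this] show ?thesis .
qed

text \<open>The type of vectors mixes all lengths, so measurability is reduced to real coordinates:
  on the carrier, \<open>f x\<close> is rebuilt by \<open>Matrix.vec k\<close> from its restricted
  coordinates. The vector operations below are all handled through this criterion.\<close>

lemma measurable_into_lborel_vec:
  assumes dim: "\<And>x. x \<in> space M \<Longrightarrow> f x \<in> carrier_vec k"
    and comp: "\<And>i. i < k \<Longrightarrow> (\<lambda>x. vec_index (f x) i) \<in> borel_measurable M"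
  shows "f \<in> measurable M (lborel_vec k)"
proof -
  have "(\<lambda>x. \<lambda>i\<in>{..<k}. vec_index (f x) i) \<in> measurable M (\<Pi>\<^sub>M i\<in>{..<k}. lborel)"
    using comp by (intro measurable_restrict) auto
  then have "(\<lambda>x. Matrix.vec k (\<lambda>i\<in>{..<k}. vec_index (f x) i)) \<in> measurable M (lborel_vec k)"
    by (rule measurable_compose[OF _ measurable_vec_lborel])
  moreover have "Matrix.vec k (\<lambda>i\<in>{..<k}. vec_index (f x) i) = f x" if "x \<in> space M" for x
    using dim[OF that] by (intro eq_vecI) auto
  ultimately show ?thesis
    by (simp cong: measurable_cong)
qed

lemma measurable_carrier_vec:
  "f \<in> measurable M (lborel_vec k) \<Longrightarrow> x \<in> space M \<Longrightarrow> f x \<in> carrier_vec k"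
  using measurable_space[of f M "lborel_vec k" x] by (simp add: space_lborel_vec)

lemma measurable_scalar_prod:
  assumes f: "f \<in> measurable M (lborel_vec k)" and g: "g \<in> measurable M (lborel_vec k)"
  shows "(\<lambda>x. scalar_prod (f x) (g x)) \<in> borel_measurable M"
proof -
  have "(\<lambda>x. \<Sum>i\<in>{0..<k}. vec_index (f x) i * vec_index (g x) i) \<in> borel_measurable M"
    using measurable_vec_index[OF f] measurable_vec_index[OF g] by auto
  also have "?this \<longleftrightarrow> ?thesis"
    using carrier_vecD[OF measurable_carrier_vec[OF g]]
    by (intro measurable_cong) (auto simp: scalar_prod_def)
  finally show ?thesis .
qed

lemma measurable_add_vec:
  assumes f: "f \<in> measurable M (lborel_vec k)" and g: "g \<in> measurable M (lborel_vec k)"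
  shows "(\<lambda>x. f x + g x) \<in> measurable M (lborel_vec k)"
proof (rule measurable_into_lborel_vec)
  fix i assume i: "i < k"
  have "(\<lambda>x. vec_index (f x) i + vec_index (g x) i) \<in> borel_measurable M"
    using measurable_vec_index[OF f i] measurable_vec_index[OF g i] by auto
  also have "?this \<longleftrightarrow> (\<lambda>x. vec_index (f x + g x) i) \<in> borel_measurable M"
    using carrier_vecD[OF measurable_carrier_vec[OF g]] i by (intro measurable_cong) auto
  finally show "(\<lambda>x. vec_index (f x + g x) i) \<in> borel_measurable M" .
qed (use measurable_carrier_vec[OF f] measurable_carrier_vec[OF g] in auto)

lemma measurable_minus_vec:
  assumes f: "f \<in> measurable M (lborel_vec k)" and g: "g \<in> measurable M (lborel_vec k)"
  shows "(\<lambda>x. f x - g x) \<in> measurable M (lborel_vec k)"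
proof (rule measurable_into_lborel_vec)
  fix i assume i: "i < k"
  have "(\<lambda>x. vec_index (f x) i - vec_index (g x) i) \<in> borel_measurable M"
    using measurable_vec_index[OF f i] measurable_vec_index[OF g i] by auto
  also have "?this \<longleftrightarrow> (\<lambda>x. vec_index (f x - g x) i) \<in> borel_measurable M"
    using carrier_vecD[OF measurable_carrier_vec[OF g]] i by (intro measurable_cong) auto
  finally show "(\<lambda>x. vec_index (f x - g x) i) \<in> borel_measurable M" .
qed (use measurable_carrier_vec[OF f] measurable_carrier_vec[OF g] in auto)

lemma measurable_const_vec: "v \<in> carrier_vec k \<Longrightarrow> (\<lambda>x. v) \<in> measurable M (lborel_vec k)"
  by (simp add: space_lborel_vec)

lemma measurable_mult_mat_vec:
  assumes f: "f \<in> measurable M (lborel_vec k)" and A: "A \<in> carrier_mat n k"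
  shows "(\<lambda>x. A *\<^sub>v f x) \<in> measurable M (lborel_vec n)"
proof (rule measurable_into_lborel_vec)
  fix i assume i: "i < n"
  have "(\<lambda>x. scalar_prod (Matrix.row A i) (f x)) \<in> borel_measurable M"
    using A by (intro measurable_scalar_prod[OF measurable_const_vec f]) auto
  also have "?this \<longleftrightarrow> (\<lambda>x. vec_index (A *\<^sub>v f x) i) \<in> borel_measurable M"
    using A i by (intro measurable_cong) auto
  finally show "(\<lambda>x. vec_index (A *\<^sub>v f x) i) \<in> borel_measurable M" .
qed (use A in \<open>auto intro!: carrier_vecI\<close>)

lemma measurable_insert_zeros:
  assumes f: "f \<in> measurable M (lborel_vec (card S))" and S: "S \<subseteq> {..<p}"
  shows "(\<lambda>x. insert_zeros p S (f x)) \<in> measurable M (lborel_vec p)"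
proof (rule measurable_into_lborel_vec)
  fix j assume j: "j < p"
  have "card {i \<in> S. i < j} < card S" if "j \<in> S"
    using that finite_subset[OF S] by (intro psubset_card_mono) auto
  then show "(\<lambda>x. vec_index (insert_zeros p S (f x)) j) \<in> borel_measurable M"
    using j measurable_vec_index[OF f] by (cases "j \<in> S") (auto simp: insert_zeros_def)
qed (auto simp: insert_zeros_def)

section \<open>Iterated integration and translation invariance on vectors\<close>

lemma nn_integral_lborel_vec:
  "f \<in> borel_measurable (lborel_vec k) \<Longrightarrow>
    nn_integral (lborel_vec k) f = (\<integral>\<^sup>+ x. f (Matrix.vec k x) \<partial>(\<Pi>\<^sub>M i\<in>{..<k}. lborel))"
  unfolding lborel_vec_def by (rule nn_integral_embed_measure'[OF inj_on_vec_space])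

lemma nn_integral_PiM_lborel_Suc:
  assumes f: "f \<in> borel_measurable (\<Pi>\<^sub>M i\<in>{..<Suc k}. (lborel :: real measure))"
  shows "(\<integral>\<^sup>+ x. f x \<partial>(\<Pi>\<^sub>M i\<in>{..<Suc k}. lborel))
    = (\<integral>\<^sup>+ x. (\<integral>\<^sup>+ t. f (x(k := t)) \<partial>lborel) \<partial>(\<Pi>\<^sub>M i\<in>{..<k}. lborel))"
proof -
  interpret product_sigma_finite "\<lambda>_::nat. lborel :: real measure"
    by standard
  show ?thesis
    using product_nn_integral_insert[of "{..<k}" k f] f by (simp add: lessThan_Suc)
qed

text \<open>Induction on the dimension with the last coordinate integrated innermost, so that each
  step uses only translation invariance on the line.\<close>

lemma nn_integral_PiM_lborel_translation:
  fixes m :: "nat \<Rightarrow> real"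
  assumes "f \<in> borel_measurable (\<Pi>\<^sub>M i\<in>{..<k}. (lborel :: real measure))"
  shows "(\<integral>\<^sup>+ x. f x \<partial>(\<Pi>\<^sub>M i\<in>{..<k}. lborel))
    = (\<integral>\<^sup>+ x. f (\<lambda>i\<in>{..<k}. m i + x i) \<partial>(\<Pi>\<^sub>M i\<in>{..<k}. lborel))"
  using assms
proof (induction k arbitrary: f)
  case 0
  then show ?case by (simp add: PiM_empty nn_integral_count_space_finite)
next
  case (Suc k)
  note [measurable] = Suc.prems
  interpret K: product_sigma_finite "\<lambda>_::nat. lborel :: real measure" by standard
  interpret L: sigma_finite_measure "lborel :: real measure" by (rule sigma_finite_lborel)
  have ins [measurable]: "(\<lambda>(x, t). x(k := t)) \<in>
      measurable ((\<Pi>\<^sub>M i\<in>{..<k}. lborel) \<Otimes>\<^sub>M lborel) (\<Pi>\<^sub>M i\<in>{..<Suc k}. (lborel :: real measure))"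
    unfolding lessThan_Suc case_prod_beta by (rule measurable_fun_upd[where J="{..<k}"]) auto
  have upd: "(\<lambda>x. x(k := t)) \<in> measurable (\<Pi>\<^sub>M i\<in>{..<k}. lborel) (\<Pi>\<^sub>M i\<in>{..<Suc k}. (lborel :: real measure))" for t
    unfolding lessThan_Suc by (rule measurable_fun_upd[where J="{..<k}"]) auto
  have fm: "(\<lambda>(x, t). f (x(k := t))) \<in> borel_measurable ((\<Pi>\<^sub>M i\<in>{..<k}. lborel) \<Otimes>\<^sub>M lborel)"
    using measurable_compose[OF ins Suc.prems] by (simp add: case_prod_beta)
  have fmt: "(\<lambda>t. f (x(k := t))) \<in> borel_measurable borel" if "x \<in> space (\<Pi>\<^sub>M i\<in>{..<k}. lborel)" for x
    using measurable_compose[OF measurable_Pair1'[OF that, of lborel] fm] by simp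
  have G: "(\<lambda>x. \<integral>\<^sup>+ t. f (x(k := t)) \<partial>lborel) \<in> borel_measurable (\<Pi>\<^sub>M i\<in>{..<k}. lborel)"
    using fm by measurable
  have tr: "(\<lambda>x. \<lambda>i\<in>{..<k'}. m i + x i) \<in>
      measurable (\<Pi>\<^sub>M i\<in>{..<k'}. lborel) (\<Pi>\<^sub>M i\<in>{..<k'}. (lborel :: real measure))" for k'
    by (intro measurable_restrict) measurable
  have "(\<integral>\<^sup>+ x. f x \<partial>(\<Pi>\<^sub>M i\<in>{..<Suc k}. lborel))
    = (\<integral>\<^sup>+ x. (\<integral>\<^sup>+ t. f (x(k := t)) \<partial>lborel) \<partial>(\<Pi>\<^sub>M i\<in>{..<k}. lborel))"
    by (rule nn_integral_PiM_lborel_Suc[OF Suc.prems])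
  \<comment> \<open>The induction hypothesis is applied to the function with the last coordinate
    already integrated out; this shifts the first \<open>k\<close> coordinates, and the next step
    shifts the last.\<close>
  also have "\<dots> = (\<integral>\<^sup>+ x. (\<integral>\<^sup>+ t. f ((\<lambda>i\<in>{..<k}. m i + x i)(k := t)) \<partial>lborel) \<partial>(\<Pi>\<^sub>M i\<in>{..<k}. lborel))"
    by (rule Suc.IH[OF G])
  also have "\<dots> = (\<integral>\<^sup>+ x. (\<integral>\<^sup>+ t. f ((\<lambda>i\<in>{..<k}. m i + x i)(k := m k + t)) \<partial>lborel) \<partial>(\<Pi>\<^sub>M i\<in>{..<k}. lborel))"
  proof (rule nn_integral_cong)
    fix x :: "nat \<Rightarrow> real" assume "x \<in> space (\<Pi>\<^sub>M i\<in>{..<k}. lborel)"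
    then have "(\<lambda>i\<in>{..<k}. m i + x i) \<in> space (\<Pi>\<^sub>M i\<in>{..<k}. lborel)"
      by (simp add: space_PiM)
    from fmt[OF this] show "(\<integral>\<^sup>+ t. f ((\<lambda>i\<in>{..<k}. m i + x i)(k := t)) \<partial>lborel)
        = (\<integral>\<^sup>+ t. f ((\<lambda>i\<in>{..<k}. m i + x i)(k := m k + t)) \<partial>lborel)"
      by (subst nn_integral_real_affine[where c=1 and t="m k"]) auto
  qed
  also have "\<dots> = (\<integral>\<^sup>+ x. (\<integral>\<^sup>+ t. f (\<lambda>i\<in>{..<Suc k}. m i + (x(k := t)) i) \<partial>lborel) \<partial>(\<Pi>\<^sub>M i\<in>{..<k}. lborel))"
    by (intro nn_integral_cong arg_cong[of _ _ f]) auto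
  also have "\<dots> = (\<integral>\<^sup>+ x. f (\<lambda>i\<in>{..<Suc k}. m i + x i) \<partial>(\<Pi>\<^sub>M i\<in>{..<Suc k}. lborel))"
    by (rule nn_integral_PiM_lborel_Suc[OF measurable_compose[OF tr Suc.prems], symmetric])
  finally show ?case .
qed

lemma nn_integral_lborel_vec_translation:
  assumes f: "f \<in> borel_measurable (lborel_vec k)" and m: "m \<in> carrier_vec k"
  shows "nn_integral (lborel_vec k) f = (\<integral>\<^sup>+ x. f (m + x) \<partial>lborel_vec k)"
proof -
  have f': "(\<lambda>x. f (m + x)) \<in> borel_measurable (lborel_vec k)"
    by (rule measurable_compose[OF measurable_add_vec[OF measurable_const_vec[OF m]] f]) simp
  have eq: "Matrix.vec k (\<lambda>i\<in>{..<k}. vec_index m i + x i) = m + Matrix.vec k x" for x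
    using m by (intro eq_vecI) auto
  show ?thesis
    unfolding nn_integral_lborel_vec[OF f] nn_integral_lborel_vec[OF f']
    using nn_integral_PiM_lborel_translation[OF measurable_compose[OF measurable_vec_lborel f],
        of "vec_index m"]
    by (simp add: eq)
qed

subsection \<open>Gaussian integrals\<close>

text \<open>Completing the square: the integrand is a multiple of the normal density with mean - b /
  d and standard deviation 1 / sqrt d.\<close>

lemma nn_integral_exp_quadratic:
  fixes q b d :: real
  assumes d: "d > 0"
  shows "(\<integral>\<^sup>+ t. ennreal (exp (- (q + 2 * b * t + d * t\<^sup>2) / 2)) \<partial>lborel)
    = ennreal (sqrt (2 * pi / d)) * ennreal (exp (- (q - b\<^sup>2 / d) / 2))"
proof -
  let ?s = "1 / sqrt d"
  have sd: "sqrt d * sqrt d = d" "sqrt d > 0" using d by auto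
  have "exp (- (q + 2 * b * t + d * t\<^sup>2) / 2)
      = sqrt (2 * pi / d) * exp (- (q - b\<^sup>2 / d) / 2) * normal_density (- b / d) ?s t" for t
  proof -
    have "- (q + 2 * b * t + d * t\<^sup>2) / 2 = - (q - b\<^sup>2 / d) / 2 - (t - - b / d)\<^sup>2 / (2 * ?s\<^sup>2)"
      using d sd by (simp add: power_divide field_simps power2_eq_square)
    moreover have "sqrt (2 * pi * ?s\<^sup>2) = sqrt (2 * pi / d)"
      using d by (simp add: power_divide)
    moreover have "sqrt (2 * pi / d) > 0" "d \<noteq> 0" using d by simp_all
    ultimately show ?thesis
      by (simp only: normal_density_def exp_diff) (simp add: exp_minus field_simps)
  qed
  then have "(\<integral>\<^sup>+ t. ennreal (exp (- (q + 2 * b * t + d * t\<^sup>2) / 2)) \<partial>lborel)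
     = (\<integral>\<^sup>+ t. ennreal (sqrt (2 * pi / d) * exp (- (q - b\<^sup>2 / d) / 2)) * ennreal (normal_density (- b / d) ?s t) \<partial>lborel)"
    using d by (simp add: ennreal_mult)
  also have "\<dots> = ennreal (sqrt (2 * pi / d) * exp (- (q - b\<^sup>2 / d) / 2)) * (\<integral>\<^sup>+ t. ennreal (normal_density (- b / d) ?s t) \<partial>lborel)"
    by (rule nn_integral_cmult) simp
  also have "(\<integral>\<^sup>+ t. ennreal (normal_density (- b / d) ?s t) \<partial>lborel) = 1"
    using d by (subst nn_integral_eq_integral) auto
  finally show ?thesis using d by (simp add: ennreal_mult)
qed

text \<open>Block elimination with the last diagonal entry as pivot: the matrix factors into two
  block triangular matrices, one carrying the Schur complement and the other the pivot.\<close>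

lemma det_schur_complement:
  fixes A :: "nat \<Rightarrow> nat \<Rightarrow> 'a :: field"
  assumes d: "A k k \<noteq> 0"
  shows "Determinant.det (Matrix.mat (Suc k) (Suc k) (\<lambda>(i, j). A i j))
    = A k k * Determinant.det (Matrix.mat k k (\<lambda>(i, j). A i j - A i k * A k j / A k k))"
proof -
  define S where "S = Matrix.mat k k (\<lambda>(i, j). A i j - A i k * A k j / A k k)"
  define B where "B = Matrix.mat k 1 (\<lambda>(i, j). A i k / A k k)"
  define C where "C = Matrix.mat 1 k (\<lambda>(i, j). A k j)"
  define D where "D = Matrix.mat 1 1 (\<lambda>(i, j). A k k)"
  have [simp]: "S \<in> carrier_mat k k" "B \<in> carrier_mat k 1" "C \<in> carrier_mat 1 k" "D \<in> carrier_mat 1 1"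
    by (auto simp: S_def B_def C_def D_def)
  have "Matrix.mat (Suc k) (Suc k) (\<lambda>(i, j). A i j)
     = four_block_mat S B (0\<^sub>m 1 k) (1\<^sub>m 1) * four_block_mat (1\<^sub>m k) (0\<^sub>m k 1) C D"
    using d
    by (subst mult_four_block_mat[where ?nr1.0=k and ?n1.0=k and ?n2.0=1 and ?nr2.0=1 and ?nc1.0=k and ?nc2.0=1])
      (auto intro!: eq_matI simp: S_def B_def C_def D_def scalar_prod_def less_Suc_eq)
  also have "Determinant.det \<dots> = Determinant.det (four_block_mat S B (0\<^sub>m 1 k) (1\<^sub>m 1))
      * Determinant.det (four_block_mat (1\<^sub>m k) (0\<^sub>m k 1) C D)"
    by (rule det_mult[of _ "k + 1"]) (rule four_block_carrier_mat; auto simp: S_def D_def)+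
  also have "Determinant.det (four_block_mat S B (0\<^sub>m 1 k) (1\<^sub>m 1)) = Determinant.det S * Determinant.det (1\<^sub>m 1 :: 'a mat)"
    by (rule det_four_block_mat_lower_left_zero) (auto simp: S_def B_def)
  also have "Determinant.det (four_block_mat (1\<^sub>m k) (0\<^sub>m k 1) C D) = Determinant.det (1\<^sub>m k :: 'a mat) * Determinant.det D"
    by (rule det_four_block_mat_upper_right_zero) (auto simp: C_def D_def)
  also have "Determinant.det D = A k k"
    by (subst det_single) (auto simp: D_def)
  finally show ?thesis by (simp add: S_def)
qed

text \<open>Integrating out the last coordinate replaces the quadratic form by that of the Schur
  complement, which is how the determinant recursion also proceeds. Index functions in place of
  matrices let the induction pass to the smaller form without carrier conditions.\<close>

lemma nn_integral_gaussian_PiM: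
  fixes A :: "nat \<Rightarrow> nat \<Rightarrow> real"
  assumes "\<And>i j. i < k \<Longrightarrow> j < k \<Longrightarrow> A i j = A j i"
    and "\<And>x. \<exists>i<k. x i \<noteq> 0 \<Longrightarrow> (\<Sum>i<k. \<Sum>j<k. A i j * x i * x j) > 0"
  shows "Determinant.det (Matrix.mat k k (\<lambda>(i, j). A i j)) > 0 \<and>
    (\<integral>\<^sup>+ x. ennreal (exp (- (\<Sum>i<k. \<Sum>j<k. A i j * x i * x j) / 2)) \<partial>(\<Pi>\<^sub>M i\<in>{..<k}. lborel))
      = ennreal (sqrt ((2 * pi) ^ k / Determinant.det (Matrix.mat k k (\<lambda>(i, j). A i j))))"
  using assms
proof (induction k arbitrary: A)
  case 0
  then show ?case by (simp add: PiM_empty nn_integral_count_space_finite)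
next
  case (Suc k)
  define d where "d = A k k"
  define S where "S i j = A i j - A i k * A k j / A k k" for i j
  let ?b = "\<lambda>x. \<Sum>i<k. A i k * x i"
  let ?Q = "\<lambda>k A x. \<Sum>i<k. \<Sum>j<k. A i j * x i * x j"
  have sym: "A i j = A j i" if "i \<le> k" "j \<le> k" for i j
    using Suc.prems(1)[of i j] that by simp
  have Qsplit: "?Q (Suc k) A (x(k := t)) = ?Q k A x + 2 * ?b x * t + d * t\<^sup>2" for x t
    by (simp add: sum.distrib sum_distrib_left sum_distrib_right d_def power2_eq_square algebra_simps sym)
  \<comment> \<open>The form evaluated at the last unit vector.\<close>
  have d: "d > 0"
    using Suc.prems(2)[of "(\<lambda>_. 0)(k := 1)"] unfolding Qsplit by auto
  have QS: "?Q k S x = ?Q k A x - (?b x)\<^sup>2 / d" for x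
  proof -
    have "?Q k S x = ?Q k A x - (\<Sum>i<k. \<Sum>j<k. (A i k * x i) * (A k j * x j) / d)"
      by (simp add: S_def d_def sum_subtractf algebra_simps)
    also have "(\<Sum>i<k. \<Sum>j<k. (A i k * x i) * (A k j * x j) / d) = (?b x)\<^sup>2 / d"
      by (simp add: sum_divide_distrib[symmetric] sum_product[symmetric] power2_eq_square sym)
    finally show ?thesis .
  qed
  have Spos: "?Q k S x > 0" if "\<exists>i<k. x i \<noteq> 0" for x
  proof -
    \<comment> \<open>The value - b / d minimises the form in the last coordinate, and the minimum
      is the Schur form; it is positive because some earlier coordinate is nonzero.\<close>
    have "?Q (Suc k) A (x(k := - ?b x / d)) > 0"
      using that by (intro Suc.prems(2)) (metis fun_upd_other less_SucI less_irrefl)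
    also have "?Q (Suc k) A (x(k := - ?b x / d)) = ?Q k S x"
      unfolding Qsplit QS using d by (simp add: field_simps power2_eq_square)
    finally show ?thesis .
  qed
  have IH: "Determinant.det (Matrix.mat k k (\<lambda>(i, j). S i j)) > 0"
    "(\<integral>\<^sup>+ x. ennreal (exp (- ?Q k S x / 2)) \<partial>(\<Pi>\<^sub>M i\<in>{..<k}. lborel))
      = ennreal (sqrt ((2 * pi) ^ k / Determinant.det (Matrix.mat k k (\<lambda>(i, j). S i j))))"
    using Suc.IH[of S] Spos by (auto simp: S_def sym)
  have det: "Determinant.det (Matrix.mat (Suc k) (Suc k) (\<lambda>(i, j). A i j))
      = d * Determinant.det (Matrix.mat k k (\<lambda>(i, j). S i j))"
    using det_schur_complement[of A k] d by (simp add: d_def S_def)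
  have "(\<integral>\<^sup>+ x. ennreal (exp (- ?Q (Suc k) A x / 2)) \<partial>(\<Pi>\<^sub>M i\<in>{..<Suc k}. lborel))
    = (\<integral>\<^sup>+ x. (\<integral>\<^sup>+ t. ennreal (exp (- ?Q (Suc k) A (x(k := t)) / 2)) \<partial>lborel) \<partial>(\<Pi>\<^sub>M i\<in>{..<k}. lborel))"
    by (rule nn_integral_PiM_lborel_Suc) measurable
  also have "\<dots> = (\<integral>\<^sup>+ x. ennreal (sqrt (2 * pi / d)) * ennreal (exp (- ?Q k S x / 2)) \<partial>(\<Pi>\<^sub>M i\<in>{..<k}. lborel))"
    unfolding Qsplit nn_integral_exp_quadratic[OF d] QS ..
  also have "\<dots> = ennreal (sqrt (2 * pi / d)) * (\<integral>\<^sup>+ x. ennreal (exp (- ?Q k S x / 2)) \<partial>(\<Pi>\<^sub>M i\<in>{..<k}. lborel))"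
    by (rule nn_integral_cmult) measurable
  also have "\<dots> = ennreal (sqrt ((2 * pi) ^ Suc k / (d * Determinant.det (Matrix.mat k k (\<lambda>(i, j). S i j)))))"
    unfolding IH(2) using IH(1) d by (simp flip: ennreal_mult real_sqrt_mult)
  finally show ?case
    unfolding det using d IH(1) by simp
qed

section \<open>Normal laws described by a precision matrix\<close>

definition pos_def_mat :: "nat \<Rightarrow> real Matrix.mat \<Rightarrow> bool" where
  "pos_def_mat k A \<longleftrightarrow> A \<in> carrier_mat k k \<and> transpose_mat A = A \<and>
     (\<forall>v\<in>carrier_vec k. v \<noteq> 0\<^sub>v k \<longrightarrow> scalar_prod v (A *\<^sub>v v) > 0)"

lemma measurable_id_vec: "(\<lambda>v. v) \<in> measurable (lborel_vec k) (lborel_vec k)"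
  by simp

lemma smult_mat_mult_vec:
  fixes A :: "'a :: comm_ring_1 Matrix.mat"
  assumes "A \<in> carrier_mat n k" and "v \<in> carrier_vec k"
  shows "(t \<cdot>\<^sub>m A) *\<^sub>v v = t \<cdot>\<^sub>v (A *\<^sub>v v)"
  using assms by (intro eq_vecI) (auto simp: scalar_prod_def sum_distrib_left mult.assoc)

lemma pos_def_mat_sym:
  assumes "pos_def_mat k A" and "i < k" and "j < k"
  shows "A $$ (i, j) = A $$ (j, i)"
proof -
  have "transpose_mat A $$ (j, i) = A $$ (j, i)" "dim_row A = k" "dim_col A = k"
    using assms by (auto simp: pos_def_mat_def)
  then show ?thesis using assms by simp
qed

lemma pos_def_mat_smult:
  assumes A: "pos_def_mat k A" and t: "t > 0"
  shows "pos_def_mat k (t \<cdot>\<^sub>m A)"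
proof -
  have "A \<in> carrier_mat k k" using A by (simp add: pos_def_mat_def)
  have "transpose_mat (t \<cdot>\<^sub>m A) = t \<cdot>\<^sub>m transpose_mat A"
    by (rule eq_matI) auto
  have "scalar_prod v ((t \<cdot>\<^sub>m A) *\<^sub>v v) = t * scalar_prod v (A *\<^sub>v v)" if "v \<in> carrier_vec k" for v
    using carrier_vecD[OF that] carrier_matD[OF \<open>A \<in> carrier_mat k k\<close>]
    by (subst smult_mat_mult_vec[OF \<open>A \<in> carrier_mat k k\<close> that]) simp
  then show ?thesis
    using A t \<open>transpose_mat (t \<cdot>\<^sub>m A) = t \<cdot>\<^sub>m transpose_mat A\<close> by (auto simp: pos_def_mat_def)
qed

lemma nn_integral_gaussian:
  assumes A: "pos_def_mat k A"
  shows "Determinant.det A > 0"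
    and "(\<integral>\<^sup>+ v. ennreal (exp (- scalar_prod v (A *\<^sub>v v) / 2)) \<partial>lborel_vec k)
      = ennreal (sqrt ((2 * pi) ^ k / Determinant.det A))"
proof -
  have Ac [simp]: "A \<in> carrier_mat k k" and sym: "transpose_mat A = A"
    using A by (auto simp: pos_def_mat_def)
  have mat: "Matrix.mat k k (\<lambda>(i, j). A $$ (i, j)) = A"
    using carrier_matD[OF Ac] by (intro eq_matI) auto
  have quad: "scalar_prod (Matrix.vec k x) (A *\<^sub>v Matrix.vec k x) = (\<Sum>i<k. \<Sum>j<k. A $$ (i, j) * x i * x j)" for x
  proof -
    have "scalar_prod (Matrix.vec k x) (A *\<^sub>v Matrix.vec k x)
      = (\<Sum>i\<in>{0..<k}. x i * (\<Sum>j\<in>{0..<k}. A $$ (i, j) * x j))"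
      using carrier_matD[OF Ac] by (auto simp: scalar_prod_def intro!: sum.cong)
    also have "\<dots> = (\<Sum>i<k. \<Sum>j<k. A $$ (i, j) * x i * x j)"
      by (simp add: sum_distrib_left atLeast0LessThan mult.assoc mult.left_commute)
    finally show ?thesis .
  qed
  have "A $$ (i, j) = A $$ (j, i)" if "i < k" "j < k" for i j
    using pos_def_mat_sym[OF A] that by blast
  moreover have "(\<Sum>i<k. \<Sum>j<k. A $$ (i, j) * x i * x j) > 0" if "\<exists>i<k. x i \<noteq> 0" for x
  proof -
    obtain i where "i < k" "x i \<noteq> 0" using \<open>\<exists>i<k. x i \<noteq> 0\<close> by blast
    then have "Matrix.vec k x \<noteq> 0\<^sub>v k"
      by (metis index_vec index_zero_vec(1))
    then have "scalar_prod (Matrix.vec k x) (A *\<^sub>v Matrix.vec k x) > 0"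
      using A by (simp add: pos_def_mat_def)
    then show ?thesis unfolding quad .
  qed
  ultimately have *: "Determinant.det A > 0 \<and>
    (\<integral>\<^sup>+ x. ennreal (exp (- (\<Sum>i<k. \<Sum>j<k. A $$ (i, j) * x i * x j) / 2)) \<partial>(\<Pi>\<^sub>M i\<in>{..<k}. lborel))
      = ennreal (sqrt ((2 * pi) ^ k / Determinant.det A))"
    using nn_integral_gaussian_PiM[of k "\<lambda>i j. A $$ (i, j)"] unfolding mat by blast
  then show "Determinant.det A > 0" ..
  have [measurable]: "(\<lambda>v. scalar_prod v (A *\<^sub>v v)) \<in> borel_measurable (lborel_vec k)"
    by (intro measurable_scalar_prod[where k=k] measurable_mult_mat_vec[OF _ Ac] measurable_id_vec)
  show "(\<integral>\<^sup>+ v. ennreal (exp (- scalar_prod v (A *\<^sub>v v) / 2)) \<partial>lborel_vec k)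
      = ennreal (sqrt ((2 * pi) ^ k / Determinant.det A))"
    using * by (subst nn_integral_lborel_vec) (measurable, simp add: quad)
qed

text \<open>\<open>mvn_density\<close> is written with the covariance \<open>V\<close> and its
  computed inverse. Carrying \<open>V\<close> together with its two-sided inverse \<open>A\<close>
  allows all integrals to be computed from the precision, which is the matrix at hand for the prior
  (a multiple of the Gram matrix) and for the noise.\<close>

locale gaussian_precision =
  fixes k :: nat and A V :: "real Matrix.mat"
  assumes pos_def: "pos_def_mat k A" and V_carrier: "V \<in> carrier_mat k k"
    and A_V: "A * V = 1\<^sub>m k" and V_A: "V * A = 1\<^sub>m k"
begin

lemma A_carrier: "A \<in> carrier_mat k k"
  using pos_def by (simp add: pos_def_mat_def)

lemma mat_inverse_V: "the (mat_inverse V) = A"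
proof (cases "mat_inverse V")
  case None
  have "V \<in> Units (ring_mat TYPE(real) k ())"
    using V_carrier A_carrier A_V V_A by (auto simp: Units_def ring_mat_def)
  with mat_inverse(1)[OF V_carrier None, of "()"] show ?thesis by simp
next
  case (Some B)
  then have B: "V * B = 1\<^sub>m k" "B \<in> carrier_mat k k"
    using mat_inverse(2)[OF V_carrier Some] by auto
  have "A = A * (V * B)" using B A_carrier by simp
  also have "\<dots> = (A * V) * B" using B A_carrier V_carrier by (simp add: assoc_mult_mat[of A k k V k B k])
  finally show ?thesis using Some B A_V by simp
qed

text \<open>The normalising constant in terms of the precision; \<open>det_V\<close> identifies it
  with the one in \<open>mvn_density\<close>.\<close>

definition Z :: real where "Z = sqrt ((2 * pi) ^ k / Determinant.det A)"

lemma det_A: "Determinant.det A > 0" and Z_pos: "Z > 0"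
  using nn_integral_gaussian(1)[OF pos_def] by (auto simp: Z_def)

lemma nn_integral_exp_precision:
  "(\<integral>\<^sup>+ v. ennreal (exp (- scalar_prod v (A *\<^sub>v v) / 2)) \<partial>lborel_vec k) = ennreal Z"
  by (simp only: nn_integral_gaussian(2)[OF pos_def] Z_def)

lemma det_V: "Determinant.det V = 1 / Determinant.det A"
  using det_mult[OF A_carrier V_carrier] det_A by (simp add: A_V field_simps)

lemma mvn_density_eq:
  "m \<in> carrier_vec k \<Longrightarrow> mvn_density m V x = exp (- scalar_prod (x - m) (A *\<^sub>v (x - m)) / 2) / Z"
  by (auto simp: mvn_density_def mat_inverse_V Z_def det_V)

lemma measurable_quadratic: "(\<lambda>v. scalar_prod v (A *\<^sub>v v)) \<in> borel_measurable (lborel_vec k)"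
  by (intro measurable_scalar_prod[where k=k] measurable_mult_mat_vec[OF _ A_carrier] measurable_id_vec)

lemma sets_mvn: "m \<in> carrier_vec k \<Longrightarrow> sets (mvn m V) = sets (lborel_vec k)"
  by (simp add: mvn_def)

lemma measurable_mvn: "m \<in> carrier_vec k \<Longrightarrow> measurable (mvn m V) N = measurable (lborel_vec k) N"
  by (intro measurable_cong_sets sets_mvn refl)

lemma space_mvn: "m \<in> carrier_vec k \<Longrightarrow> space (mvn m V) = carrier_vec k"
  by (simp add: mvn_def space_lborel_vec)

lemma nn_integral_mvn:
  assumes f: "f \<in> borel_measurable (lborel_vec k)" and m: "m \<in> carrier_vec k"
  shows "(\<integral>\<^sup>+ x. f x \<partial>mvn m V)
    = (\<integral>\<^sup>+ u. ennreal (exp (- scalar_prod u (A *\<^sub>v u) / 2) / Z) * f (m + u) \<partial>lborel_vec k)"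
proof -
  note [measurable] = f
  have [measurable]: "(\<lambda>x. scalar_prod (x - m) (A *\<^sub>v (x - m))) \<in> borel_measurable (lborel_vec k)"
    by (intro measurable_scalar_prod[where k=k] measurable_mult_mat_vec[OF _ A_carrier] measurable_minus_vec
        measurable_const_vec m measurable_id_vec)
  have "(\<integral>\<^sup>+ x. f x \<partial>mvn m V)
     = (\<integral>\<^sup>+ x. ennreal (exp (- scalar_prod (x - m) (A *\<^sub>v (x - m)) / 2) / Z) * f x \<partial>lborel_vec k)"
    using m unfolding mvn_def mvn_density_eq[OF m] by (subst nn_integral_density) auto
  also have "\<dots> = (\<integral>\<^sup>+ u. ennreal (exp (- scalar_prod (m + u - m) (A *\<^sub>v (m + u - m)) / 2) / Z) * f (m + u) \<partial>lborel_vec k)"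
    by (rule nn_integral_lborel_vec_translation[OF _ m]) measurable
  also have "\<dots> = (\<integral>\<^sup>+ u. ennreal (exp (- scalar_prod u (A *\<^sub>v u) / 2) / Z) * f (m + u) \<partial>lborel_vec k)"
  proof (rule nn_integral_cong)
    fix u :: "real Matrix.vec" assume "u \<in> space (lborel_vec k)"
    then have "u \<in> carrier_vec k" by (simp add: space_lborel_vec)
    then have "m + u - m = u" using m by (intro eq_vecI) auto
    then show "ennreal (exp (- scalar_prod (m + u - m) (A *\<^sub>v (m + u - m)) / 2) / Z) * f (m + u)
      = ennreal (exp (- scalar_prod u (A *\<^sub>v u) / 2) / Z) * f (m + u)" by simp
  qed
  finally show ?thesis .
qed

lemma nn_integral_mvn_0:
  assumes f: "f \<in> borel_measurable (lborel_vec k)"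
  shows "(\<integral>\<^sup>+ x. f x \<partial>mvn (0\<^sub>v k) V)
    = (\<integral>\<^sup>+ u. ennreal (exp (- scalar_prod u (A *\<^sub>v u) / 2) / Z) * f u \<partial>lborel_vec k)"
  unfolding nn_integral_mvn[OF f zero_carrier_vec]
  by (intro nn_integral_cong) (simp add: space_lborel_vec)

lemma nn_integral_mvn_centered:
  assumes f: "f \<in> borel_measurable (lborel_vec k)" and m: "m \<in> carrier_vec k"
  shows "(\<integral>\<^sup>+ x. f x \<partial>mvn m V) = (\<integral>\<^sup>+ u. f (m + u) \<partial>mvn (0\<^sub>v k) V)"
proof -
  have "(\<lambda>u. f (m + u)) \<in> borel_measurable (lborel_vec k)"
    by (rule measurable_compose[OF measurable_add_vec[OF measurable_const_vec[OF m]] f]) simp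
  then show ?thesis
    unfolding nn_integral_mvn[OF f m] by (simp add: nn_integral_mvn_0)
qed

lemma prob_space_mvn:
  assumes m: "m \<in> carrier_vec k"
  shows "prob_space (mvn m V)"
proof
  note [measurable] = measurable_quadratic
  have "emeasure (mvn m V) (space (mvn m V)) = (\<integral>\<^sup>+ x. 1 \<partial>mvn m V)" by simp
  also have "\<dots> = (\<integral>\<^sup>+ u. ennreal (inverse Z) * ennreal (exp (- scalar_prod u (A *\<^sub>v u) / 2)) \<partial>lborel_vec k)"
    using Z_pos by (subst nn_integral_mvn[OF _ m]) (auto simp flip: ennreal_mult simp: field_simps)
  also have "\<dots> = ennreal (inverse Z) * ennreal Z"
    unfolding nn_integral_exp_precision[symmetric]
    by (rule nn_integral_cmult) measurable
  also have "\<dots> = 1" using Z_pos by (simp flip: ennreal_mult)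
  finally show "emeasure (mvn m V) (space (mvn m V)) = 1" .
qed

text \<open>Moment generating function by exponential tilting: translating by w = V b absorbs the
  linear term, since A w = b, and leaves the constant b . w / 2.\<close>

lemma nn_integral_mvn_exp_linear:
  assumes b: "b \<in> carrier_vec k"
  shows "(\<integral>\<^sup>+ u. ennreal (exp (scalar_prod b u)) \<partial>mvn (0\<^sub>v k) V) = ennreal (exp (scalar_prod b (V *\<^sub>v b) / 2))"
proof -
  define w where "w = V *\<^sub>v b"
  have w: "w \<in> carrier_vec k" using V_carrier b by (simp add: w_def)
  have Aw: "A *\<^sub>v w = b"
    using A_carrier V_carrier b by (simp add: w_def A_V flip: assoc_mult_mat_vec)
  note [measurable] = measurable_quadratic
  have [measurable]: "(\<lambda>u. scalar_prod b u) \<in> borel_measurable (lborel_vec k)"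
    by (intro measurable_scalar_prod[where k=k] measurable_const_vec b measurable_id_vec)
  interpret P: prob_space "mvn (0\<^sub>v k) V" by (rule prob_space_mvn) simp
  have eq: "- scalar_prod (w + u) (A *\<^sub>v (w + u)) / 2 + scalar_prod b (w + u)
      = - scalar_prod u (A *\<^sub>v u) / 2 + scalar_prod b w / 2" if u: "u \<in> carrier_vec k" for u
  proof -
    have Au: "A *\<^sub>v u \<in> carrier_vec k" using A_carrier u by simp
    have "transpose_mat A = A" using pos_def by (simp add: pos_def_mat_def)
    then have "scalar_prod w (A *\<^sub>v u) = scalar_prod b u"
      using transpose_vec_mult_scalar[OF A_carrier u w] Aw u b
      by (simp add: comm_scalar_prod[of u k])
    moreover have "A *\<^sub>v (w + u) = b + A *\<^sub>v u"
      using A_carrier w u Aw by (simp add: mult_add_distrib_mat_vec)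
    ultimately show ?thesis
      using w u b Au
      by (simp add: scalar_prod_add_distrib[of _ k] add_scalar_prod_distrib[of _ k]
          comm_scalar_prod[of u k b] comm_scalar_prod[of w k b] field_simps)
  qed
  have "(\<integral>\<^sup>+ u. ennreal (exp (scalar_prod b u)) \<partial>mvn (0\<^sub>v k) V)
     = (\<integral>\<^sup>+ u. ennreal (exp (- scalar_prod u (A *\<^sub>v u) / 2) / Z) * ennreal (exp (scalar_prod b u)) \<partial>lborel_vec k)"
    by (rule nn_integral_mvn_0) measurable
  also have "\<dots> = (\<integral>\<^sup>+ u. ennreal (exp (- scalar_prod u (A *\<^sub>v u) / 2 + scalar_prod b u) / Z) \<partial>lborel_vec k)"
    using Z_pos unfolding exp_add by (simp flip: ennreal_mult)
  also have "\<dots> = (\<integral>\<^sup>+ u. ennreal (exp (- scalar_prod (w + u) (A *\<^sub>v (w + u)) / 2 + scalar_prod b (w + u)) / Z) \<partial>lborel_vec k)"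
    by (rule nn_integral_lborel_vec_translation[OF _ w]) measurable
  also have "\<dots> = (\<integral>\<^sup>+ u. ennreal (exp (- scalar_prod u (A *\<^sub>v u) / 2) / Z) * ennreal (exp (scalar_prod b w / 2)) \<partial>lborel_vec k)"
  proof (rule nn_integral_cong)
    fix u :: "real Matrix.vec" assume "u \<in> space (lborel_vec k)"
    then have u: "u \<in> carrier_vec k" by (simp add: space_lborel_vec)
    show "ennreal (exp (- scalar_prod (w + u) (A *\<^sub>v (w + u)) / 2 + scalar_prod b (w + u)) / Z)
      = ennreal (exp (- scalar_prod u (A *\<^sub>v u) / 2) / Z) * ennreal (exp (scalar_prod b w / 2))"
      unfolding eq[OF u] exp_add using Z_pos by (simp flip: ennreal_mult)
  qed
  also have "\<dots> = (\<integral>\<^sup>+ u. ennreal (exp (scalar_prod b w / 2)) \<partial>mvn (0\<^sub>v k) V)"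
    by (rule nn_integral_mvn_0[symmetric]) measurable
  finally show ?thesis by (simp add: w_def P.emeasure_space_1)
qed

text \<open>The factor rescales the precision by 1 + \<tau>, hence its determinant by the
  \<open>k\<close>-th power. Positive \<tau> is used for the likelihood under the prior, negative
  \<tau> for exponential moments of projected noise.\<close>

lemma nn_integral_mvn_exp_quadratic:
  assumes \<tau>: "\<tau> > -1"
  shows "(\<integral>\<^sup>+ u. ennreal (exp (- (\<tau> / 2) * scalar_prod u (A *\<^sub>v u))) \<partial>mvn (0\<^sub>v k) V)
    = ennreal ((1 + \<tau>) powr (- real k / 2))"
proof -
  have pd: "pos_def_mat k ((1 + \<tau>) \<cdot>\<^sub>m A)" using \<tau> by (intro pos_def_mat_smult pos_def) auto
  note [measurable] = measurable_quadratic
  have "(\<integral>\<^sup>+ u. ennreal (exp (- (\<tau> / 2) * scalar_prod u (A *\<^sub>v u))) \<partial>mvn (0\<^sub>v k) V)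
    = (\<integral>\<^sup>+ u. ennreal (exp (- scalar_prod u (A *\<^sub>v u) / 2) / Z) * ennreal (exp (- (\<tau> / 2) * scalar_prod u (A *\<^sub>v u))) \<partial>lborel_vec k)"
    by (rule nn_integral_mvn_0) measurable
  also have "\<dots> = (\<integral>\<^sup>+ u. ennreal (inverse Z) * ennreal (exp (- scalar_prod u (((1 + \<tau>) \<cdot>\<^sub>m A) *\<^sub>v u) / 2)) \<partial>lborel_vec k)"
  proof (rule nn_integral_cong)
    fix u :: "real Matrix.vec" assume "u \<in> space (lborel_vec k)"
    then have u: "u \<in> carrier_vec k" by (simp add: space_lborel_vec)
    have "scalar_prod u (((1 + \<tau>) \<cdot>\<^sub>m A) *\<^sub>v u) = (1 + \<tau>) * scalar_prod u (A *\<^sub>v u)"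
      using carrier_vecD[OF u] carrier_matD[OF A_carrier]
      by (subst smult_mat_mult_vec[OF A_carrier u]) simp
    then have "- scalar_prod u (((1 + \<tau>) \<cdot>\<^sub>m A) *\<^sub>v u) / 2
        = - scalar_prod u (A *\<^sub>v u) / 2 + - (\<tau> / 2) * scalar_prod u (A *\<^sub>v u)"
      by (simp add: field_simps)
    then show "ennreal (exp (- scalar_prod u (A *\<^sub>v u) / 2) / Z) * ennreal (exp (- (\<tau> / 2) * scalar_prod u (A *\<^sub>v u)))
      = ennreal (inverse Z) * ennreal (exp (- scalar_prod u (((1 + \<tau>) \<cdot>\<^sub>m A) *\<^sub>v u) / 2))"
      using Z_pos by (simp only: exp_add) (simp add: field_simps flip: ennreal_mult)
  qed
  also have "\<dots> = ennreal (inverse Z) * (\<integral>\<^sup>+ u. ennreal (exp (- scalar_prod u (((1 + \<tau>) \<cdot>\<^sub>m A) *\<^sub>v u) / 2)) \<partial>lborel_vec k)"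
  proof (rule nn_integral_cmult)
    have [measurable]: "(\<lambda>v. scalar_prod v (((1 + \<tau>) \<cdot>\<^sub>m A) *\<^sub>v v)) \<in> borel_measurable (lborel_vec k)"
      using A_carrier
      by (intro measurable_scalar_prod[where k=k] measurable_mult_mat_vec measurable_id_vec) auto
    show "(\<lambda>u. ennreal (exp (- scalar_prod u (((1 + \<tau>) \<cdot>\<^sub>m A) *\<^sub>v u) / 2))) \<in> borel_measurable (lborel_vec k)"
      by measurable
  qed
  also have "\<dots> = ennreal (inverse Z) * ennreal (sqrt ((2 * pi) ^ k / ((1 + \<tau>) ^ k * Determinant.det A)))"
    using carrier_matD[OF A_carrier] by (simp only: nn_integral_gaussian(2)[OF pd] det_smult)
  also have "sqrt ((2 * pi) ^ k / ((1 + \<tau>) ^ k * Determinant.det A)) = Z * (1 + \<tau>) powr (- real k / 2)"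
  proof -
    have "sqrt ((1 + \<tau>) ^ k) = (1 + \<tau>) powr (real k / 2)"
      using \<tau> by (simp add: powr_half_sqrt[symmetric] powr_powr powr_realpow[symmetric])
    then show ?thesis
      using \<tau> by (simp add: Z_def real_sqrt_divide real_sqrt_mult powr_minus field_simps)
  qed
  finally show ?thesis using Z_pos by (simp flip: ennreal_mult add: field_simps)
qed

end

subsection \<open>Least squares\<close>

abbreviation sqn :: "real Matrix.vec \<Rightarrow> real" where
  "sqn v \<equiv> scalar_prod v v"

lemma sqn_nonneg: "sqn v \<ge> 0"
  by (auto simp: scalar_prod_def intro!: sum_nonneg)

lemma sqn_eq_0: "v \<in> carrier_vec n \<Longrightarrow> sqn v = 0 \<Longrightarrow> v = 0\<^sub>v n"
  using conjugate_square_eq_0_vec[of v n] by simp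

lemma sqn_add:
  assumes "u \<in> carrier_vec n" and "v \<in> carrier_vec n"
  shows "sqn (u + v) = sqn u + 2 * scalar_prod u v + sqn v"
  using assms
  by (simp add: scalar_prod_add_distrib[of _ n] add_scalar_prod_distrib[of _ n] comm_scalar_prod[of v n u])

lemma sqn_minus:
  assumes "u \<in> carrier_vec n" and "v \<in> carrier_vec n"
  shows "sqn (u - v) = sqn u - 2 * scalar_prod u v + sqn v"
  using assms
  by (simp add: scalar_prod_minus_distrib[of _ n] minus_scalar_prod_distrib[of _ n] comm_scalar_prod[of v n u])

lemma sqn_add_le:
  assumes "u \<in> carrier_vec n" and "v \<in> carrier_vec n"
  shows "sqn (u + v) \<le> 2 * sqn u + 2 * sqn v"
  using sqn_add[OF assms] sqn_minus[OF assms] sqn_nonneg[of "u - v"] by simp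

lemma mat_inverse_invertible:
  fixes A :: "real Matrix.mat"
  assumes A: "A \<in> carrier_mat k k" and inv: "invertible_mat A"
  shows "the (mat_inverse A) \<in> carrier_mat k k"
    and "A * the (mat_inverse A) = 1\<^sub>m k" and "the (mat_inverse A) * A = 1\<^sub>m k"
proof -
  from inv obtain B where B: "A * B = 1\<^sub>m (dim_row A)" "B * A = 1\<^sub>m (dim_row B)"
    by (auto simp: invertible_mat_def inverts_mat_def)
  have "dim_col B = k" "dim_row B = k"
    using arg_cong[OF B(1), of dim_col] arg_cong[OF B(2), of dim_col] A by auto
  then have "A \<in> Units (ring_mat TYPE(real) k ())"
    using A B by (auto simp: Units_def ring_mat_def intro!: exI[of _ B])
  then obtain C where "mat_inverse A = Some C"
    using mat_inverse(1)[OF A, of "()"] by (cases "mat_inverse A") auto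
  with mat_inverse(2)[OF A this] show "the (mat_inverse A) \<in> carrier_mat k k"
    and "A * the (mat_inverse A) = 1\<^sub>m k" and "the (mat_inverse A) * A = 1\<^sub>m k"
    by auto
qed

lemma gaussian_precision_isotropic:
  assumes t: "t > 0"
  shows "gaussian_precision n ((1 / t) \<cdot>\<^sub>m 1\<^sub>m n) (t \<cdot>\<^sub>m 1\<^sub>m n)"
proof
  have "pos_def_mat n (1\<^sub>m n)"
    using sqn_nonneg sqn_eq_0 by (fastforce simp: pos_def_mat_def less_le)
  then show "pos_def_mat n ((1 / t) \<cdot>\<^sub>m 1\<^sub>m n)"
    using t by (intro pos_def_mat_smult) auto
qed (use t in \<open>auto simp: mult_smult_distrib[of _ n n] mult_smult_assoc_mat[of _ n n]\<close>)

lemma nn_integral_isotropic_exp_linear: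
  assumes t: "t > 0" and b: "b \<in> carrier_vec n"
  shows "(\<integral>\<^sup>+ u. ennreal (exp (scalar_prod b u)) \<partial>mvn (0\<^sub>v n) (t \<cdot>\<^sub>m 1\<^sub>m n)) = ennreal (exp (t * sqn b / 2))"
proof -
  interpret gaussian_precision n "(1 / t) \<cdot>\<^sub>m 1\<^sub>m n" "t \<cdot>\<^sub>m 1\<^sub>m n"
    by (rule gaussian_precision_isotropic[OF t])
  have "scalar_prod b ((t \<cdot>\<^sub>m 1\<^sub>m n) *\<^sub>v b) = t * sqn b"
    using b by (subst smult_mat_mult_vec[of _ n n]) auto
  then show ?thesis
    using nn_integral_mvn_exp_linear[OF b] by simp
qed

text \<open>\<open>W\<close> stands for the columns of one model. \<open>fit\<close> is the
  orthogonal projection onto its column space, and \<open>y - fit y\<close> is the residual.\<close>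

locale linear_design =
  fixes n k :: nat and W :: "real Matrix.mat"
  assumes W_carrier: "W \<in> carrier_mat n k"
    and invertible: "invertible_mat (transpose_mat W * W)"
begin

definition G :: "real Matrix.mat" where "G = transpose_mat W * W"
definition Gi :: "real Matrix.mat" where "Gi = the (mat_inverse G)"
definition ls :: "real Matrix.vec \<Rightarrow> real Matrix.vec" where "ls y = Gi *\<^sub>v (transpose_mat W *\<^sub>v y)"
definition fit :: "real Matrix.vec \<Rightarrow> real Matrix.vec" where "fit y = W *\<^sub>v ls y"

lemma Wt_carrier: "transpose_mat W \<in> carrier_mat k n"
  using W_carrier by simp

lemma G_carrier: "G \<in> carrier_mat k k"
  using W_carrier Wt_carrier by (simp add: G_def)

lemma Gi_carrier: "Gi \<in> carrier_mat k k" and G_Gi: "G * Gi = 1\<^sub>m k" and Gi_G: "Gi * G = 1\<^sub>m k"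
  using mat_inverse_invertible[OF G_carrier] invertible by (simp_all add: Gi_def G_def)

lemma W_mult: "u \<in> carrier_vec k \<Longrightarrow> W *\<^sub>v u \<in> carrier_vec n"
  using W_carrier by simp

lemma Wt_mult: "y \<in> carrier_vec n \<Longrightarrow> transpose_mat W *\<^sub>v y \<in> carrier_vec k"
  using Wt_carrier by simp

lemma ls_carrier: "y \<in> carrier_vec n \<Longrightarrow> ls y \<in> carrier_vec k"
  using Gi_carrier Wt_mult by (simp add: ls_def)

lemma fit_carrier: "y \<in> carrier_vec n \<Longrightarrow> fit y \<in> carrier_vec n"
  by (simp add: fit_def W_mult ls_carrier)

lemma G_mult: "u \<in> carrier_vec k \<Longrightarrow> G *\<^sub>v u = transpose_mat W *\<^sub>v (W *\<^sub>v u)"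
  unfolding G_def by (rule assoc_mult_mat_vec[OF Wt_carrier W_carrier])

lemma Wt_scalar:
  "y \<in> carrier_vec n \<Longrightarrow> u \<in> carrier_vec k \<Longrightarrow>
    scalar_prod (transpose_mat W *\<^sub>v y) u = scalar_prod y (W *\<^sub>v u)"
  by (rule transpose_vec_mult_scalar[OF W_carrier])

lemma quadratic_G: "u \<in> carrier_vec k \<Longrightarrow> scalar_prod u (G *\<^sub>v u) = sqn (W *\<^sub>v u)"
  using Wt_scalar[OF W_mult, of u u] comm_scalar_prod[of u k "G *\<^sub>v u"] G_carrier
  by (simp add: G_mult Wt_mult W_mult)

text \<open>An invertible Gram matrix makes \<open>W\<close> injective: if \<open>W\<close> kills
  \<open>u\<close>, then so does \<open>G\<close>, and \<open>Gi\<close> recovers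
  \<open>u\<close>.\<close>

lemma pos_def_G: "pos_def_mat k G"
  unfolding pos_def_mat_def
proof (intro conjI ballI impI)
  show "transpose_mat G = G"
    using transpose_mult[OF Wt_carrier W_carrier] by (simp add: G_def)
  fix u :: "real Matrix.vec" assume u: "u \<in> carrier_vec k" and "u \<noteq> 0\<^sub>v k"
  have "W *\<^sub>v u \<noteq> 0\<^sub>v n"
  proof
    assume "W *\<^sub>v u = 0\<^sub>v n"
    then have "G *\<^sub>v u = 0\<^sub>v k"
      using carrier_matD[OF W_carrier] by (auto simp: G_mult u scalar_prod_def intro!: eq_vecI)
    then have "Gi *\<^sub>v (G *\<^sub>v u) = 0\<^sub>v k"
      using carrier_matD[OF Gi_carrier] by (auto simp: scalar_prod_def intro!: eq_vecI)
    then have "u = 0\<^sub>v k"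
      using u G_carrier Gi_carrier by (simp add: Gi_G flip: assoc_mult_mat_vec)
    with \<open>u \<noteq> 0\<^sub>v k\<close> show False ..
  qed
  then have "sqn (W *\<^sub>v u) \<noteq> 0" using sqn_eq_0[OF W_mult[OF u]] by blast
  then show "scalar_prod u (G *\<^sub>v u) > 0"
    using quadratic_G[OF u] sqn_nonneg[of "W *\<^sub>v u"] by simp
qed (rule G_carrier)

lemma gaussian_precision_G:
  assumes t: "t > 0"
  shows "gaussian_precision k ((1 / t) \<cdot>\<^sub>m G) (t \<cdot>\<^sub>m Gi)"
proof
  show "pos_def_mat k ((1 / t) \<cdot>\<^sub>m G)"
    using t by (intro pos_def_mat_smult pos_def_G) auto
  have "(1 / t) \<cdot>\<^sub>m G * (t \<cdot>\<^sub>m Gi) = t \<cdot>\<^sub>m ((1 / t) \<cdot>\<^sub>m (G * Gi))"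
    using G_carrier Gi_carrier by (simp add: mult_smult_distrib[of _ k k] mult_smult_assoc_mat[of _ k k])
  also have "\<dots> = 1\<^sub>m k" using t by (auto simp: G_Gi intro!: eq_matI)
  finally show "(1 / t) \<cdot>\<^sub>m G * (t \<cdot>\<^sub>m Gi) = 1\<^sub>m k" .
  have "(t \<cdot>\<^sub>m Gi) * ((1 / t) \<cdot>\<^sub>m G) = (1 / t) \<cdot>\<^sub>m (t \<cdot>\<^sub>m (Gi * G))"
    using G_carrier Gi_carrier by (simp add: mult_smult_distrib[of _ k k] mult_smult_assoc_mat[of _ k k])
  also have "\<dots> = 1\<^sub>m k" using t by (auto simp: Gi_G intro!: eq_matI)
  finally show "(t \<cdot>\<^sub>m Gi) * ((1 / t) \<cdot>\<^sub>m G) = 1\<^sub>m k" .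
qed (use Gi_carrier in auto)

lemma G_ls: "y \<in> carrier_vec n \<Longrightarrow> G *\<^sub>v ls y = transpose_mat W *\<^sub>v y"
  using G_carrier Gi_carrier Wt_mult[of y] by (simp add: ls_def G_Gi flip: assoc_mult_mat_vec)

lemma ls_add:
  "y \<in> carrier_vec n \<Longrightarrow> z \<in> carrier_vec n \<Longrightarrow> ls (y + z) = ls y + ls z"
  unfolding ls_def
  using mult_add_distrib_mat_vec[OF Wt_carrier, of y z] mult_add_distrib_mat_vec[OF Gi_carrier]
  by (simp add: Wt_mult)

lemma fit_add:
  "y \<in> carrier_vec n \<Longrightarrow> z \<in> carrier_vec n \<Longrightarrow> fit (y + z) = fit y + fit z"
  unfolding fit_def using mult_add_distrib_mat_vec[OF W_carrier] by (simp add: ls_add ls_carrier)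

text \<open>The normal equations \<open>G_ls\<close>, read as orthogonality of the residual to the
  column space.\<close>

lemma fit_orthogonal:
  assumes y: "y \<in> carrier_vec n" and u: "u \<in> carrier_vec k"
  shows "scalar_prod (y - fit y) (W *\<^sub>v u) = 0"
proof -
  have "transpose_mat W *\<^sub>v fit y = transpose_mat W *\<^sub>v y"
    using G_ls[OF y] G_mult[OF ls_carrier[OF y]] by (simp add: fit_def)
  then have "scalar_prod (fit y) (W *\<^sub>v u) = scalar_prod y (W *\<^sub>v u)"
    using Wt_scalar[OF y u] Wt_scalar[OF fit_carrier[OF y] u] by simp
  then show ?thesis
    using minus_scalar_prod_distrib[OF y fit_carrier[OF y] W_mult[OF u]] by simp
qed

lemma scalar_fit:
  "y \<in> carrier_vec n \<Longrightarrow> u \<in> carrier_vec k \<Longrightarrow> scalar_prod (fit y) (W *\<^sub>v u) = scalar_prod y (W *\<^sub>v u)"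
  using fit_orthogonal[of y u] minus_scalar_prod_distrib[OF _ fit_carrier W_mult, of y y u] by simp

text \<open>Pythagoras. With \<open>u\<close> the deviation of the coefficients from least squares,
  the likelihood splits into the residual of the model and a quadratic form in \<open>u\<close>
  proportional to the prior precision.\<close>

lemma sqn_residual_shift:
  assumes y: "y \<in> carrier_vec n" and u: "u \<in> carrier_vec k"
  shows "sqn (y - W *\<^sub>v (ls y + u)) = sqn (y - fit y) + sqn (W *\<^sub>v u)"
proof -
  have "y - W *\<^sub>v (ls y + u) = (y - fit y) - W *\<^sub>v u"
    using mult_add_distrib_mat_vec[OF W_carrier ls_carrier[OF y] u] y fit_carrier[OF y] W_mult[OF u]
    by (auto simp: fit_def intro!: eq_vecI)
  then show ?thesis
    using sqn_minus[of "y - fit y" n "W *\<^sub>v u"] fit_orthogonal[OF y u] y fit_carrier[OF y] W_mult[OF u]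
    by simp
qed

lemma sqn_residual_minimal:
  assumes y: "y \<in> carrier_vec n" and u: "u \<in> carrier_vec k"
  shows "sqn (y - fit y) \<le> sqn (y - W *\<^sub>v u)"
proof -
  have "ls y + (u - ls y) = u" using ls_carrier[OF y] u by (intro eq_vecI) auto
  then show ?thesis
    using sqn_residual_shift[OF y, of "u - ls y"] ls_carrier[OF y] u sqn_nonneg[of "W *\<^sub>v (u - ls y)"] by simp
qed

text \<open>The error is projected noise minus the bias \<open>\<mu> - fit \<mu>\<close>, and the
  bias is orthogonal to the column space.\<close>

lemma sqn_fit_error:
  assumes \<mu>: "\<mu> \<in> carrier_vec n" and z: "z \<in> carrier_vec n"
  shows "sqn (fit (\<mu> + z) - \<mu>) = sqn (fit z) + sqn (\<mu> - fit \<mu>)"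
proof -
  have "fit (\<mu> + z) - \<mu> = fit z - (\<mu> - fit \<mu>)"
    using \<mu> z fit_carrier[OF \<mu>] fit_carrier[OF z] by (intro eq_vecI) (auto simp: fit_add)
  moreover have "scalar_prod (fit z) (\<mu> - fit \<mu>) = 0"
    using fit_orthogonal[OF \<mu> ls_carrier[OF z]] \<mu> fit_carrier[OF \<mu>] fit_carrier[OF z]
    by (subst comm_scalar_prod[of _ n]) (auto simp: fit_def[of z])
  ultimately show ?thesis
    using sqn_minus[of "fit z" n "\<mu> - fit \<mu>"] \<mu> z fit_carrier by simp
qed

text \<open>The residual is the bias plus \<open>z - fit z\<close>. The bias is orthogonal to
  \<open>fit z\<close>, so the cross term sees all of \<open>z\<close>; it is the only term linear
  in the noise.\<close>

lemma sqn_residual: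
  assumes \<mu>: "\<mu> \<in> carrier_vec n" and z: "z \<in> carrier_vec n"
  shows "sqn (\<mu> + z - fit (\<mu> + z))
    = sqn (\<mu> - fit \<mu>) + 2 * scalar_prod (\<mu> - fit \<mu>) z + sqn z - sqn (fit z)"
proof -
  let ?m = "\<mu> - fit \<mu>" and ?r = "z - fit z"
  have c: "?m \<in> carrier_vec n" "?r \<in> carrier_vec n" "fit z \<in> carrier_vec n"
    using \<mu> z fit_carrier by auto
  have "\<mu> + z - fit (\<mu> + z) = ?m + ?r"
    using \<mu> z fit_carrier[OF \<mu>] fit_carrier[OF z] by (intro eq_vecI) (auto simp: fit_add)
  moreover have "scalar_prod ?m ?r = scalar_prod ?m z"
    using scalar_prod_minus_distrib[OF c(1) z c(3)] fit_orthogonal[OF \<mu> ls_carrier[OF z]]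
    by (simp add: fit_def[of z])
  moreover have "sqn ?r = sqn z - sqn (fit z)"
  proof -
    have "scalar_prod z (fit z) = sqn (fit z)"
      using scalar_fit[OF z ls_carrier[OF z]] by (simp add: fit_def[of z])
    then show ?thesis using sqn_minus[OF z c(3)] by simp
  qed
  ultimately show ?thesis using sqn_add[OF c(1,2)] by simp
qed

lemma measurable_ls:
  assumes "f \<in> measurable M (lborel_vec n)"
  shows "(\<lambda>x. ls (f x)) \<in> measurable M (lborel_vec k)"
  unfolding ls_def
  by (intro measurable_mult_mat_vec[OF _ Gi_carrier] measurable_mult_mat_vec[OF _ Wt_carrier] assms)

lemma measurable_fit:
  assumes "f \<in> measurable M (lborel_vec n)"
  shows "(\<lambda>x. fit (f x)) \<in> measurable M (lborel_vec n)"
  unfolding fit_def by (intro measurable_mult_mat_vec[OF _ W_carrier] measurable_ls assms)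

text \<open>The quadratic form \<open>sqn (fit z)\<close> is linearised by a Gaussian integral over the coefficients
  (Hubbard--Stratonovich), after which the integral over \<open>z\<close> is a moment generating function.\<close>

lemma nn_integral_exp_fit:
  assumes \<sigma>: "\<sigma> > 0" and \<tau>: "0 \<le> \<tau>" "\<tau> < 1" and b: "b \<in> carrier_vec n"
    and orth: "\<And>u. u \<in> carrier_vec k \<Longrightarrow> scalar_prod b (W *\<^sub>v u) = 0"
  shows "(\<integral>\<^sup>+ z. ennreal (exp (\<tau> / (2 * \<sigma>\<^sup>2) * sqn (fit z) + scalar_prod b z)) \<partial>mvn (0\<^sub>v n) (\<sigma>\<^sup>2 \<cdot>\<^sub>m 1\<^sub>m n))
    = ennreal ((1 - \<tau>) powr (- real k / 2) * exp (\<sigma>\<^sup>2 * sqn b / 2))"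
proof -
  \<comment> \<open>The transform of N(0, \<open>Gi\<close>) at \<kappa> times the transpose of
    \<open>W\<close> applied to \<open>z\<close> is exp (\<kappa>^2 |fit z|^2 / 2), so this \<kappa>
    gives exactly the exponent \<tau> / (2 \<sigma>^2).\<close>
  define \<kappa> where "\<kappa> = sqrt \<tau> / \<sigma>"
  have \<kappa>2: "\<kappa>\<^sup>2 = \<tau> / \<sigma>\<^sup>2" using \<tau> \<sigma> by (simp add: \<kappa>_def power_divide)
  interpret N: gaussian_precision n "(1 / \<sigma>\<^sup>2) \<cdot>\<^sub>m 1\<^sub>m n" "\<sigma>\<^sup>2 \<cdot>\<^sub>m 1\<^sub>m n"
    using \<sigma> by (intro gaussian_precision_isotropic) simp
  have "gaussian_precision k ((1 / 1) \<cdot>\<^sub>m G) (1 \<cdot>\<^sub>m Gi)"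
    by (rule gaussian_precision_G) simp
  moreover have "(1 / 1) \<cdot>\<^sub>m G = G" "1 \<cdot>\<^sub>m Gi = Gi" by (auto intro!: eq_matI)
  ultimately interpret K: gaussian_precision k G Gi by simp
  let ?N = "mvn (0\<^sub>v n) (\<sigma>\<^sup>2 \<cdot>\<^sub>m 1\<^sub>m n)" and ?K = "mvn (0\<^sub>v k) Gi"
  interpret PN: prob_space ?N by (rule N.prob_space_mvn) simp
  interpret PK: prob_space ?K by (rule K.prob_space_mvn) simp
  interpret NK: pair_sigma_finite ?N ?K ..
  have setsN: "sets ?N = sets (lborel_vec n)" and setsK: "sets ?K = sets (lborel_vec k)"
    by (simp_all add: N.sets_mvn K.sets_mvn)
  let ?F = "\<lambda>z u. ennreal (exp (scalar_prod b z + \<kappa> * scalar_prod (transpose_mat W *\<^sub>v z) u))"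
  have fst: "fst \<in> measurable (?N \<Otimes>\<^sub>M ?K) (lborel_vec n)" and snd: "snd \<in> measurable (?N \<Otimes>\<^sub>M ?K) (lborel_vec k)"
    using measurable_fst[of ?N ?K] measurable_snd[of ?N ?K] measurable_cong_sets[OF refl setsN] measurable_cong_sets[OF refl setsK]
    by auto
  have [measurable]: "(\<lambda>x. scalar_prod b (fst x)) \<in> borel_measurable (?N \<Otimes>\<^sub>M ?K)"
    by (rule measurable_scalar_prod[OF measurable_const_vec[OF b] fst])
  have [measurable]: "(\<lambda>x. scalar_prod (transpose_mat W *\<^sub>v fst x) (snd x)) \<in> borel_measurable (?N \<Otimes>\<^sub>M ?K)"
    by (rule measurable_scalar_prod[OF measurable_mult_mat_vec[OF fst Wt_carrier] snd])
  have F: "(\<lambda>(z, u). ?F z u) \<in> borel_measurable (?N \<Otimes>\<^sub>M ?K)"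
    unfolding case_prod_beta by measurable
  have inner_u: "ennreal (exp (\<tau> / (2 * \<sigma>\<^sup>2) * sqn (fit z) + scalar_prod b z)) = (\<integral>\<^sup>+ u. ?F z u \<partial>?K)"
    if z: "z \<in> carrier_vec n" for z
  proof -
    let ?c = "\<kappa> \<cdot>\<^sub>v (transpose_mat W *\<^sub>v z)"
    have c: "?c \<in> carrier_vec k" using Wt_mult[OF z] by simp
    have [measurable]: "(\<lambda>u. scalar_prod ?c u) \<in> borel_measurable (lborel_vec k)"
      by (rule measurable_scalar_prod[OF measurable_const_vec[OF c] measurable_id_vec])
    have "(\<integral>\<^sup>+ u. ?F z u \<partial>?K) = (\<integral>\<^sup>+ u. ennreal (exp (scalar_prod b z)) * ennreal (exp (scalar_prod ?c u)) \<partial>?K)"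
      using Wt_mult[OF z] by (intro nn_integral_cong) (auto simp: K.space_mvn exp_add simp flip: ennreal_mult)
    also have "\<dots> = ennreal (exp (scalar_prod b z)) * (\<integral>\<^sup>+ u. ennreal (exp (scalar_prod ?c u)) \<partial>?K)"
      by (rule nn_integral_cmult) (simp add: K.measurable_mvn)
    also have "\<dots> = ennreal (exp (scalar_prod b z)) * ennreal (exp (scalar_prod ?c (Gi *\<^sub>v ?c) / 2))"
      by (simp only: K.nn_integral_mvn_exp_linear[OF c])
    also have "scalar_prod ?c (Gi *\<^sub>v ?c) = \<kappa>\<^sup>2 * sqn (fit z)"
    proof -
      have "scalar_prod ?c (Gi *\<^sub>v ?c) = \<kappa>\<^sup>2 * scalar_prod (transpose_mat W *\<^sub>v z) (ls z)"
        using Wt_mult[OF z] ls_carrier[OF z] mult_mat_vec[OF Gi_carrier Wt_mult[OF z], of \<kappa>]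
        by (simp add: ls_def power2_eq_square)
      also have "scalar_prod (transpose_mat W *\<^sub>v z) (ls z) = sqn (fit z)"
        using Wt_scalar[OF z ls_carrier[OF z]] scalar_fit[OF z ls_carrier[OF z]] by (simp add: fit_def[of z])
      finally show ?thesis .
    qed
    finally show ?thesis
      by (simp add: \<kappa>2 exp_add mult.commute flip: ennreal_mult)
  qed
  \<comment> \<open>By \<open>orth\<close> the linear functional \<open>b\<close> and the auxiliary
    direction do not interact, so \<open>b\<close> and \<open>u\<close> separate. What remains in
    \<open>u\<close> is exp of half \<tau> times its own precision form, integrable because \<tau> <
    1; the double minus matches \<open>nn_integral_mvn_exp_quadratic\<close> at - \<tau>.\<close>
  have inner_z: "(\<integral>\<^sup>+ z. ?F z u \<partial>?N)
      = ennreal (exp (\<sigma>\<^sup>2 * sqn b / 2)) * ennreal (exp (- (- \<tau> / 2) * scalar_prod u (G *\<^sub>v u)))"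
    if u: "u \<in> carrier_vec k" for u
  proof -
    let ?c = "b + \<kappa> \<cdot>\<^sub>v (W *\<^sub>v u)"
    have c: "?c \<in> carrier_vec n" using b W_mult[OF u] by simp
    have "(\<integral>\<^sup>+ z. ?F z u \<partial>?N) = (\<integral>\<^sup>+ z. ennreal (exp (scalar_prod ?c z)) \<partial>?N)"
    proof (rule nn_integral_cong)
      fix z assume "z \<in> space ?N"
      then have z: "z \<in> carrier_vec n" by (simp add: N.space_mvn)
      have "scalar_prod (transpose_mat W *\<^sub>v z) u = scalar_prod (W *\<^sub>v u) z"
        using Wt_scalar[OF z u] comm_scalar_prod[OF z W_mult[OF u]] by simp
      then show "?F z u = ennreal (exp (scalar_prod ?c z))"
        using b z W_mult[OF u] by (simp add: add_scalar_prod_distrib[of _ n])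
    qed
    also have "\<dots> = ennreal (exp (\<sigma>\<^sup>2 * sqn ?c / 2))"
      using \<sigma> by (intro nn_integral_isotropic_exp_linear c) simp
    also have "sqn ?c = sqn b + \<kappa>\<^sup>2 * scalar_prod u (G *\<^sub>v u)"
      using sqn_add[of b n "\<kappa> \<cdot>\<^sub>v (W *\<^sub>v u)"] b W_mult[OF u] orth[OF u]
      by (simp add: quadratic_G[OF u] power2_eq_square)
    also have "\<sigma>\<^sup>2 * (sqn b + \<kappa>\<^sup>2 * scalar_prod u (G *\<^sub>v u)) / 2
        = \<sigma>\<^sup>2 * sqn b / 2 + - (- \<tau> / 2) * scalar_prod u (G *\<^sub>v u)"
      using \<sigma> by (simp add: \<kappa>2 field_simps)
    finally show ?thesis
      by (simp only: exp_add) (simp flip: ennreal_mult)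
  qed
  have "(\<integral>\<^sup>+ z. ennreal (exp (\<tau> / (2 * \<sigma>\<^sup>2) * sqn (fit z) + scalar_prod b z)) \<partial>?N)
      = (\<integral>\<^sup>+ z. \<integral>\<^sup>+ u. ?F z u \<partial>?K \<partial>?N)"
    by (intro nn_integral_cong inner_u) (simp add: N.space_mvn)
  also have "\<dots> = (\<integral>\<^sup>+ u. \<integral>\<^sup>+ z. ?F z u \<partial>?N \<partial>?K)"
    by (rule NK.Fubini'[OF F, symmetric])
  also have "\<dots> = (\<integral>\<^sup>+ u. ennreal (exp (\<sigma>\<^sup>2 * sqn b / 2)) * ennreal (exp (- (- \<tau> / 2) * scalar_prod u (G *\<^sub>v u))) \<partial>?K)"
    by (intro nn_integral_cong inner_z) (simp add: K.space_mvn)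
  also have "\<dots> = ennreal (exp (\<sigma>\<^sup>2 * sqn b / 2)) * (\<integral>\<^sup>+ u. ennreal (exp (- (- \<tau> / 2) * scalar_prod u (G *\<^sub>v u))) \<partial>?K)"
  proof (rule nn_integral_cmult)
    note [measurable] = K.measurable_quadratic
    show "(\<lambda>u. ennreal (exp (- (- \<tau> / 2) * scalar_prod u (G *\<^sub>v u)))) \<in> borel_measurable ?K"
      unfolding K.measurable_mvn[OF zero_carrier_vec] by measurable
  qed
  also have "\<dots> = ennreal (exp (\<sigma>\<^sup>2 * sqn b / 2)) * ennreal ((1 - \<tau>) powr (- real k / 2))"
    using K.nn_integral_mvn_exp_quadratic[of "- \<tau>"] \<tau> by simp
  finally show ?thesis by (simp add: mult.commute flip: ennreal_mult)
qed

end

subsection \<open>The empirical Bayes posterior\<close>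

lemma columns_mat_carrier:
  assumes X: "X \<in> carrier_mat n p" and S: "S \<subseteq> {..<p}"
  shows "columns_mat X S \<in> carrier_mat n (card S)"
proof (rule carrier_matI)
  have "{j. j < p \<and> j \<in> S} = S" using S by blast
  then show "dim_col (columns_mat X S) = card S"
    using carrier_matD(2)[OF X] by (simp only: columns_mat_def dim_submatrix)
  show "dim_row (columns_mat X S) = n"
    using carrier_matD(1)[OF X] by (simp add: columns_mat_def dim_submatrix)
qed

lemma columns_mat_index:
  assumes X: "X \<in> carrier_mat n p" and S: "S \<subseteq> {..<p}" and i: "i < n" and l: "l < card S"
  shows "columns_mat X S $$ (i, l) = X $$ (i, pick S l)"
proof -
  have "{j. j < p \<and> j \<in> S} = S" using S by blast
  then have "l < card {j. j < dim_col X \<and> j \<in> S}" using carrier_matD(2)[OF X] l by (simp only:)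
  moreover have "i < card {j. j < dim_row X \<and> j \<in> UNIV}" using carrier_matD(1)[OF X] i by simp
  ultimately show ?thesis
    unfolding columns_mat_def by (simp only: submatrix_index pick_UNIV)
qed

text \<open>Columns outside \<open>S\<close> meet zeros. On \<open>S\<close>, \<open>pick S\<close>
  and counting smaller elements are mutually inverse, which reindexes the sum by position.\<close>

lemma mult_insert_zeros:
  assumes X: "X \<in> carrier_mat n p" and S: "S \<subseteq> {..<p}" and b: "b \<in> carrier_vec (card S)"
  shows "X *\<^sub>v insert_zeros p S b = columns_mat X S *\<^sub>v b"
proof (rule eq_vecI)
  note C = columns_mat_carrier[OF X S]
  fix i assume "i < dim_vec (columns_mat X S *\<^sub>v b)"
  then have i: "i < n" using C by simp
  have fin: "finite S" using finite_subset[OF S] by simp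
  have "vec_index (X *\<^sub>v insert_zeros p S b) i
      = (\<Sum>j\<in>{0..<p}. X $$ (i, j) * (if j \<in> S then vec_index b (card {a \<in> S. a < j}) else 0))"
    using X i by (auto simp: scalar_prod_def insert_zeros_def intro!: sum.cong)
  also have "\<dots> = (\<Sum>j\<in>S. X $$ (i, j) * vec_index b (card {a \<in> S. a < j}))"
    using S by (intro sum.mono_neutral_cong_right) auto
  also have "\<dots> = (\<Sum>l\<in>{0..<card S}. X $$ (i, pick S l) * vec_index b l)"
  proof (rule sum.reindex_bij_witness[of _ "pick S" "\<lambda>j. card {a \<in> S. a < j}"])
    fix j assume j: "j \<in> S"
    show eq: "pick S (card {a \<in> S. a < j}) = j" using pick_card_in_set[OF j] by simp
    show "card {a \<in> S. a < j} \<in> {0..<card S}"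
      using j fin by (auto intro!: psubset_card_mono)
    show "X $$ (i, pick S (card {a \<in> S. a < j})) * vec_index b (card {a \<in> S. a < j})
      = X $$ (i, j) * vec_index b (card {a \<in> S. a < j})" unfolding eq ..
  qed (auto intro: pick_in_set_le card_pick_le)
  also have "\<dots> = vec_index (columns_mat X S *\<^sub>v b) i"
    using C i b by (auto simp: scalar_prod_def columns_mat_index[OF X S] intro!: sum.cong)
  finally show "vec_index (X *\<^sub>v insert_zeros p S b) i = vec_index (columns_mat X S *\<^sub>v b) i" .
qed (use X columns_mat_carrier[OF X S] in auto)

text \<open>Together with \<open>mult_insert_zeros\<close> this places the true mean in the column
  space of the model given by the true support.\<close>

lemma insert_zeros_support:
  assumes \<beta>: "\<beta> \<in> carrier_vec p"
  obtains b where "b \<in> carrier_vec (card (support_vec \<beta>))" and "insert_zeros p (support_vec \<beta>) b = \<beta>"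
proof
  let ?S = "support_vec \<beta>"
  let ?b = "Matrix.vec (card ?S) (\<lambda>l. vec_index \<beta> (pick ?S l))"
  show "?b \<in> carrier_vec (card ?S)" by simp
  have fin: "finite ?S" by (simp add: support_vec_def)
  show "insert_zeros p ?S ?b = \<beta>"
  proof (rule eq_vecI)
    fix j assume "j < dim_vec \<beta>"
    then have j: "j < p" using \<beta> by simp
    show "vec_index (insert_zeros p ?S ?b) j = vec_index \<beta> j"
    proof (cases "j \<in> ?S")
      case True
      then have "card {a \<in> ?S. a < j} < card ?S" using fin by (auto intro!: psubset_card_mono)
      with True j pick_card_in_set[OF True] show ?thesis by (simp add: insert_zeros_def)
    next
      case False
      then show ?thesis using j \<beta> by (auto simp: insert_zeros_def support_vec_def)
    qed
  qed (use \<beta> in \<open>simp add: insert_zeros_def\<close>)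
qed

text \<open>One fixed sample size: all bounds proved here are finite-sample with explicit constants,
  and limits are taken only in the final theorem.\<close>

locale eb_regression =
  fixes n p :: nat and X :: "real Matrix.mat" and \<sigma> a c \<gamma> \<alpha> :: real
  assumes \<sigma>: "\<sigma> > 0" and c: "c > 0" and \<gamma>: "\<gamma> > 0" and \<alpha>: "0 < \<alpha>" "\<alpha> < 1"
    and p: "p > 0"
    and X: "X \<in> carrier_mat n p"
    and gram_invertible: "\<And>S. S \<in> models X \<Longrightarrow> invertible_mat (gram_mat X S)"
begin

abbreviation "prior \<equiv> empirical_prior \<sigma> a c \<gamma> X"
abbreviation "cprior \<equiv> conditional_prior \<sigma> \<gamma> X"
abbreviation "posterior \<equiv> eb_posterior \<sigma> a c \<gamma> \<alpha> X"
abbreviation "\<pi> \<equiv> model_prior a c X"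
abbreviation "mfit S \<equiv> linear_design.fit (columns_mat X S)"
text \<open>With \<open>mfit S\<close> as the projection P_S onto the columns in \<open>S\<close>,
  this is I - P_S: a residual when applied to data, the bias of the model when applied to the true
  mean.\<close>

abbreviation "mres S v \<equiv> v - linear_design.fit (columns_mat X S) v"

lemma models_subset: "S \<in> models X \<Longrightarrow> S \<subseteq> {..<p}"
  using X by (simp add: models_def)

lemma finite_models: "finite (models X)"
  by (rule finite_subset[of _ "Pow {..<p}"]) (use models_subset in auto)

lemma empty_model: "{} \<in> models X"
  by (simp add: models_def)

lemma linear_design_columns: "S \<in> models X \<Longrightarrow> linear_design n (card S) (columns_mat X S)"
  using columns_mat_carrier[OF X models_subset] gram_invertible[of S]
  by (simp add: linear_design_def gram_mat_def)

lemma model_prior_pos: "S \<in> models X \<Longrightarrow> \<pi> S > 0"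
proof -
  assume S: "S \<in> models X"
  have dim: "dim_col X = p" using X by simp
  have "card S \<le> p" using card_mono[OF _ models_subset[OF S]] by simp
  moreover have "c * real p powr a > 0" using c p by simp
  moreover have "(\<Sum>l\<le>mat_rank X. inverse ((c * real p powr a) ^ l)) > 0"
    using c p by (intro sum_pos) auto
  ultimately show "\<pi> S > 0"
    by (simp add: model_prior_def size_prior_def dim)
qed

lemma gaussian_precision_model:
  "S \<in> models X \<Longrightarrow> gaussian_precision (card S) ((\<gamma> / \<sigma>\<^sup>2) \<cdot>\<^sub>m linear_design.G (columns_mat X S))
    ((\<sigma>\<^sup>2 / \<gamma>) \<cdot>\<^sub>m linear_design.Gi (columns_mat X S))"
  using linear_design.gaussian_precision_G[OF linear_design_columns, of S "\<sigma>\<^sup>2 / \<gamma>"] \<sigma> \<gamma> by simp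

lemma conditional_prior_eq:
  assumes S: "S \<in> models X"
  shows "cprior y S =
    distr (mvn (linear_design.ls (columns_mat X S) y) ((\<sigma>\<^sup>2 / \<gamma>) \<cdot>\<^sub>m linear_design.Gi (columns_mat X S)))
      (lborel_vec p) (insert_zeros p S)"
proof -
  interpret D: linear_design n "card S" "columns_mat X S" by (rule linear_design_columns[OF S])
  show ?thesis
    using X by (simp add: conditional_prior_def least_squares_def gram_mat_def D.ls_def D.Gi_def D.G_def)
qed

context
  fixes S :: "nat set" and y :: "real Matrix.vec"
  assumes S: "S \<in> models X" and y: "y \<in> carrier_vec n"
begin

interpretation D: linear_design n "card S" "columns_mat X S" by (rule linear_design_columns[OF S])
interpretation P: gaussian_precision "card S" "(\<gamma> / \<sigma>\<^sup>2) \<cdot>\<^sub>m D.G" "(\<sigma>\<^sup>2 / \<gamma>) \<cdot>\<^sub>m D.Gi"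
  by (rule gaussian_precision_model[OF S])

lemma measurable_insert_zeros_mvn:
  "insert_zeros p S \<in> measurable (mvn (D.ls y) ((\<sigma>\<^sup>2 / \<gamma>) \<cdot>\<^sub>m D.Gi)) (lborel_vec p)"
  unfolding P.measurable_mvn[OF D.ls_carrier[OF y]]
  by (rule measurable_insert_zeros[OF measurable_id_vec models_subset[OF S]])

lemma prob_space_conditional_prior: "prob_space (cprior y S)"
  unfolding conditional_prior_eq[OF S]
  by (rule prob_space.prob_space_distr[OF P.prob_space_mvn[OF D.ls_carrier[OF y]] measurable_insert_zeros_mvn])

lemma nn_integral_conditional_prior:
  assumes h: "h \<in> borel_measurable (lborel_vec p)"
  shows "(\<integral>\<^sup>+ b. h b \<partial>cprior y S)
    = (\<integral>\<^sup>+ u. h (insert_zeros p S (D.ls y + u)) \<partial>mvn (0\<^sub>v (card S)) ((\<sigma>\<^sup>2 / \<gamma>) \<cdot>\<^sub>m D.Gi))"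
proof -
  have "(\<lambda>u. h (insert_zeros p S u)) \<in> borel_measurable (lborel_vec (card S))"
    by (rule measurable_compose[OF measurable_insert_zeros[OF measurable_id_vec models_subset[OF S]] h])
  from P.nn_integral_mvn_centered[OF this D.ls_carrier[OF y]] show ?thesis
    unfolding conditional_prior_eq[OF S]
    by (subst nn_integral_distr[OF measurable_insert_zeros_mvn]) (use h in auto)
qed

text \<open>By \<open>sqn_residual_shift\<close> the likelihood multiplies the prior precision
  \<gamma> G / \<sigma>^2 by 1 + \<alpha> / \<gamma>, and each dimension contributes the inverse
  square root of that factor.\<close>

lemma nn_integral_conditional_prior_exp:
  "(\<integral>\<^sup>+ b. ennreal (exp (- \<alpha> / (2 * \<sigma>\<^sup>2) * sqn (y - X *\<^sub>v b))) \<partial>cprior y S)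
    = ennreal (exp (- \<alpha> / (2 * \<sigma>\<^sup>2) * sqn (mres S y)) * (\<gamma> / (\<alpha> + \<gamma>)) powr (real (card S) / 2))"
proof -
  let ?K = "mvn (0\<^sub>v (card S)) ((\<sigma>\<^sup>2 / \<gamma>) \<cdot>\<^sub>m D.Gi)"
  let ?A = "(\<gamma> / \<sigma>\<^sup>2) \<cdot>\<^sub>m D.G"
  have h: "(\<lambda>b. ennreal (exp (- \<alpha> / (2 * \<sigma>\<^sup>2) * sqn (y - X *\<^sub>v b)))) \<in> borel_measurable (lborel_vec p)"
  proof -
    have [measurable]: "(\<lambda>b. sqn (y - X *\<^sub>v b)) \<in> borel_measurable (lborel_vec p)"
      by (intro measurable_scalar_prod[where k=n] measurable_minus_vec measurable_const_vec y
          measurable_mult_mat_vec[OF _ X] measurable_id_vec)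
    show ?thesis by measurable
  qed
  have "(\<integral>\<^sup>+ b. ennreal (exp (- \<alpha> / (2 * \<sigma>\<^sup>2) * sqn (y - X *\<^sub>v b))) \<partial>cprior y S)
    = (\<integral>\<^sup>+ u. ennreal (exp (- \<alpha> / (2 * \<sigma>\<^sup>2) * sqn (mres S y))) *
         ennreal (exp (- (\<alpha> / \<gamma> / 2) * scalar_prod u (?A *\<^sub>v u))) \<partial>?K)"
    unfolding nn_integral_conditional_prior[OF h]
  proof (rule nn_integral_cong)
    fix u assume "u \<in> space ?K"
    then have u: "u \<in> carrier_vec (card S)" by (simp add: P.space_mvn)
    have "X *\<^sub>v insert_zeros p S (D.ls y + u) = columns_mat X S *\<^sub>v (D.ls y + u)"
      using D.ls_carrier[OF y] u by (intro mult_insert_zeros[OF X models_subset[OF S]]) simp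
    then have 1: "sqn (y - X *\<^sub>v insert_zeros p S (D.ls y + u)) = sqn (mres S y) + sqn (columns_mat X S *\<^sub>v u)"
      using D.sqn_residual_shift[OF y u] by simp
    have 2: "scalar_prod u (?A *\<^sub>v u) = \<gamma> / \<sigma>\<^sup>2 * sqn (columns_mat X S *\<^sub>v u)"
      using D.quadratic_G[OF u] D.G_carrier u by (subst smult_mat_mult_vec[OF D.G_carrier u]) auto
    have 3: "- \<alpha> / (2 * \<sigma>\<^sup>2) * (sqn (mres S y) + sqn (columns_mat X S *\<^sub>v u))
      = - \<alpha> / (2 * \<sigma>\<^sup>2) * sqn (mres S y) + - (\<alpha> / \<gamma> / 2) * scalar_prod u (?A *\<^sub>v u)"
      using \<sigma> \<gamma> by (simp add: 2 field_simps)
    show "ennreal (exp (- \<alpha> / (2 * \<sigma>\<^sup>2) * sqn (y - X *\<^sub>v insert_zeros p S (D.ls y + u))))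
      = ennreal (exp (- \<alpha> / (2 * \<sigma>\<^sup>2) * sqn (mres S y))) *
         ennreal (exp (- (\<alpha> / \<gamma> / 2) * scalar_prod u (?A *\<^sub>v u)))"
      unfolding 1 3 exp_add by (simp add: ennreal_mult)
  qed
  also have "\<dots> = ennreal (exp (- \<alpha> / (2 * \<sigma>\<^sup>2) * sqn (mres S y))) *
      (\<integral>\<^sup>+ u. ennreal (exp (- (\<alpha> / \<gamma> / 2) * scalar_prod u (?A *\<^sub>v u))) \<partial>?K)"
  proof (subst nn_integral_cmult)
    note [measurable] = P.measurable_quadratic
    show "(\<lambda>u. ennreal (exp (- (\<alpha> / \<gamma> / 2) * scalar_prod u (?A *\<^sub>v u)))) \<in> borel_measurable ?K"
      unfolding P.measurable_mvn[OF zero_carrier_vec] by measurable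
  qed simp
  also have "(\<integral>\<^sup>+ u. ennreal (exp (- (\<alpha> / \<gamma> / 2) * scalar_prod u (?A *\<^sub>v u))) \<partial>?K)
      = ennreal ((1 + \<alpha> / \<gamma>) powr (- real (card S) / 2))"
    using \<alpha> \<gamma> by (intro P.nn_integral_mvn_exp_quadratic) (simp add: less_trans[of "-1" 0])
  also have "(1 + \<alpha> / \<gamma>) powr (- real (card S) / 2) = (\<gamma> / (\<alpha> + \<gamma>)) powr (real (card S) / 2)"
  proof -
    have "\<gamma> / (\<alpha> + \<gamma>) = inverse (1 + \<alpha> / \<gamma>)" using \<alpha> \<gamma> by (simp add: field_simps)
    then show ?thesis using \<alpha> \<gamma> by (simp only: inverse_powr) (simp add: powr_minus)
  qed
  finally show ?thesis by (simp add: ennreal_mult)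
qed

lemma nn_integral_conditional_prior_exp_risk:
  assumes \<mu>: "\<mu> \<in> carrier_vec n" and \<eta>: "0 \<le> \<eta>" "4 * \<eta> \<le> \<alpha>"
  shows "(\<integral>\<^sup>+ b. ennreal (exp (\<eta> / \<sigma>\<^sup>2 * sqn (X *\<^sub>v b - \<mu>)) * exp (- \<alpha> / (2 * \<sigma>\<^sup>2) * sqn (y - X *\<^sub>v b))) \<partial>cprior y S)
    \<le> ennreal (exp (2 * \<eta> / \<sigma>\<^sup>2 * sqn (mfit S y - \<mu>) - \<alpha> / (2 * \<sigma>\<^sup>2) * sqn (mres S y)))"
proof -
  let ?K = "mvn (0\<^sub>v (card S)) ((\<sigma>\<^sup>2 / \<gamma>) \<cdot>\<^sub>m D.Gi)"
  interpret K: prob_space ?K by (rule P.prob_space_mvn) simp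
  let ?h = "\<lambda>b. ennreal (exp (\<eta> / \<sigma>\<^sup>2 * sqn (X *\<^sub>v b - \<mu>)) * exp (- \<alpha> / (2 * \<sigma>\<^sup>2) * sqn (y - X *\<^sub>v b)))"
  let ?c = "2 * \<eta> / \<sigma>\<^sup>2 * sqn (mfit S y - \<mu>) - \<alpha> / (2 * \<sigma>\<^sup>2) * sqn (mres S y)"
  have h: "?h \<in> borel_measurable (lborel_vec p)"
  proof -
    have [measurable]: "(\<lambda>b. sqn (y - X *\<^sub>v b)) \<in> borel_measurable (lborel_vec p)"
      "(\<lambda>b. sqn (X *\<^sub>v b - \<mu>)) \<in> borel_measurable (lborel_vec p)"
      by (intro measurable_scalar_prod[where k=n] measurable_minus_vec measurable_const_vec y \<mu>
          measurable_mult_mat_vec[OF _ X] measurable_id_vec)+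
    show ?thesis by measurable
  qed
  have "(\<integral>\<^sup>+ b. ?h b \<partial>cprior y S) \<le> (\<integral>\<^sup>+ u. ennreal (exp ?c) \<partial>?K)"
    unfolding nn_integral_conditional_prior[OF h]
  proof (rule nn_integral_mono)
    fix u assume "u \<in> space ?K"
    then have u: "u \<in> carrier_vec (card S)" by (simp add: P.space_mvn)
    let ?w = "columns_mat X S *\<^sub>v u"
    have w: "?w \<in> carrier_vec n" and f: "D.fit y \<in> carrier_vec n"
      using D.W_mult[OF u] D.fit_carrier[OF y] by auto
    have eq: "X *\<^sub>v insert_zeros p S (D.ls y + u) = columns_mat X S *\<^sub>v (D.ls y + u)"
      using D.ls_carrier[OF y] u by (intro mult_insert_zeros[OF X models_subset[OF S]]) simp
    have 1: "sqn (y - columns_mat X S *\<^sub>v (D.ls y + u)) = sqn (mres S y) + sqn ?w"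
      using D.sqn_residual_shift[OF y u] by simp
    have "v + ?w - \<mu> = (v - \<mu>) + ?w" if "v \<in> carrier_vec n" for v
      using carrier_vecD[OF that] carrier_vecD[OF w] carrier_vecD[OF \<mu>] by (intro eq_vecI) simp_all
    then have "columns_mat X S *\<^sub>v (D.ls y + u) - \<mu> = (D.fit y - \<mu>) + ?w"
      using mult_add_distrib_mat_vec[OF D.W_carrier D.ls_carrier[OF y] u] f by (simp add: D.fit_def)
    then have 2: "sqn (columns_mat X S *\<^sub>v (D.ls y + u) - \<mu>) \<le> 2 * sqn (D.fit y - \<mu>) + 2 * sqn ?w"
      using sqn_add_le[of "D.fit y - \<mu>" n ?w] f \<mu> w by simp
    have "\<eta> / \<sigma>\<^sup>2 * sqn (columns_mat X S *\<^sub>v (D.ls y + u) - \<mu>) + - \<alpha> / (2 * \<sigma>\<^sup>2) * (sqn (mres S y) + sqn ?w)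
      \<le> \<eta> / \<sigma>\<^sup>2 * (2 * sqn (D.fit y - \<mu>) + 2 * sqn ?w) + - \<alpha> / (2 * \<sigma>\<^sup>2) * (sqn (mres S y) + sqn ?w)"
      using 2 \<eta> \<sigma> by (intro add_right_mono mult_left_mono) auto
    also have "\<dots> = ?c - (\<alpha> - 4 * \<eta>) / (2 * \<sigma>\<^sup>2) * sqn ?w"
      using \<sigma> by (simp add: field_simps)
    also have "\<dots> \<le> ?c"
      using \<eta> sqn_nonneg[of ?w] by simp
    finally show "?h (insert_zeros p S (D.ls y + u)) \<le> ennreal (exp ?c)"
      unfolding eq 1 by (simp add: exp_add[symmetric])
  qed
  also have "\<dots> = ennreal (exp ?c)" by (simp add: K.emeasure_space_1)
  finally show ?thesis .
qed

end

section \<open>The mixture prior, its evidence and the normalised posterior\<close>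

context
  fixes y :: "real Matrix.vec"
  assumes y: "y \<in> carrier_vec n"
begin

lemma kernel_conditional_prior:
  "cprior y \<in> measurable (point_measure (models X) (\<lambda>S. ennreal (\<pi> S))) (subprob_algebra (lborel_vec p))"
  using prob_space_conditional_prior[OF _ y]
  by (auto simp: space_subprob_algebra conditional_prior_eq intro!: prob_space_imp_subprob_space)

lemma nn_integral_prior:
  assumes h: "h \<in> borel_measurable (lborel_vec p)"
  shows "(\<integral>\<^sup>+ b. h b \<partial>prior y) = (\<Sum>S\<in>models X. ennreal (\<pi> S) * (\<integral>\<^sup>+ b. h b \<partial>cprior y S))"
  unfolding empirical_prior_def nn_integral_bind[OF h kernel_conditional_prior]
  by (rule nn_integral_point_measure_finite[OF finite_models])

lemma sets_prior: "sets (prior y) = sets (lborel_vec p)"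
  \<comment> \<open>\<open>sets_bind\<close> requires a nonempty space for the first measure; the
    empty model supplies a point.\<close>
  unfolding empirical_prior_def using empty_model
  by (intro sets_bind) (auto simp: space_point_measure conditional_prior_eq)

lemma measurable_prior: "measurable (prior y) N = measurable (lborel_vec p) N"
  by (intro measurable_cong_sets sets_prior refl)

lemma space_prior: "space (prior y) = carrier_vec p"
  using sets_eq_imp_space_eq[OF sets_prior] by (simp add: space_lborel_vec)

text \<open>The \<alpha>-th power of the normalising constant of the Gaussian likelihood. It is
  common to all models and cancels in the posterior.\<close>

definition "norm_const = ((1 / \<sigma>\<^sup>2) ^ n / (2 * pi) ^ n) powr (\<alpha> / 2)"

lemma norm_const_pos: "norm_const > 0"
  using \<sigma> by (simp add: norm_const_def)

lemma likelihood_powr: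
  assumes b: "b \<in> carrier_vec p"
  shows "likelihood \<sigma> X y b powr \<alpha> = norm_const * exp (- \<alpha> / (2 * \<sigma>\<^sup>2) * sqn (y - X *\<^sub>v b))"
proof -
  interpret N: gaussian_precision n "(1 / \<sigma>\<^sup>2) \<cdot>\<^sub>m 1\<^sub>m n" "\<sigma>\<^sup>2 \<cdot>\<^sub>m 1\<^sub>m n"
    using \<sigma> by (intro gaussian_precision_isotropic) simp
  have Xb: "X *\<^sub>v b \<in> carrier_vec n" using X b by simp
  let ?r = "y - X *\<^sub>v b"
  have r: "?r \<in> carrier_vec n" using y Xb by simp
  have q: "scalar_prod ?r (((1 / \<sigma>\<^sup>2) \<cdot>\<^sub>m 1\<^sub>m n) *\<^sub>v ?r) = sqn ?r / \<sigma>\<^sup>2"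
    using r by (subst smult_mat_mult_vec[of _ n n]) auto
  have "dim_row X = n" using X by simp
  then have "likelihood \<sigma> X y b = exp (- (sqn ?r / \<sigma>\<^sup>2) / 2) / N.Z"
    unfolding likelihood_def by (simp only: N.mvn_density_eq[OF Xb] q)
  also have "\<dots> powr \<alpha> = exp (- (sqn ?r / \<sigma>\<^sup>2) / 2) powr \<alpha> * (1 / N.Z) powr \<alpha>"
    using N.Z_pos by (simp flip: powr_mult)
  also have "exp (- (sqn ?r / \<sigma>\<^sup>2) / 2) powr \<alpha> = exp (- \<alpha> / (2 * \<sigma>\<^sup>2) * sqn ?r)"
    by (simp add: powr_def mult_ac)
  also have "1 / N.Z = ((1 / \<sigma>\<^sup>2) ^ n / (2 * pi) ^ n) powr (1 / 2)"
    using \<sigma> by (simp add: N.Z_def powr_half_sqrt real_sqrt_divide)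
  also have "\<dots> powr \<alpha> = norm_const"
    by (simp add: norm_const_def powr_powr)
  finally show ?thesis by simp
qed

lemma measurable_residual: "(\<lambda>b. sqn (y - X *\<^sub>v b)) \<in> borel_measurable (lborel_vec p)"
  by (intro measurable_scalar_prod[where k=n] measurable_minus_vec measurable_const_vec y
      measurable_mult_mat_vec[OF _ X] measurable_id_vec)

lemma measurable_likelihood_powr: "(\<lambda>b. likelihood \<sigma> X y b powr \<alpha>) \<in> borel_measurable (lborel_vec p)"
proof -
  note [measurable] = measurable_residual
  have "(\<lambda>b. norm_const * exp (- \<alpha> / (2 * \<sigma>\<^sup>2) * sqn (y - X *\<^sub>v b))) \<in> borel_measurable (lborel_vec p)"
    by measurable
  then show ?thesis
    by (rule measurable_cong[THEN iffD2, rotated]) (simp add: likelihood_powr space_lborel_vec)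
qed

text \<open>A nonnegative integral in place of the Bochner integral in \<open>eb_posterior\<close>;
  the two agree through \<open>enn2real\<close>, and positivity together with finiteness makes the
  division legitimate.\<close>

definition "evidence = (\<integral>\<^sup>+ b. ennreal (likelihood \<sigma> X y b powr \<alpha>) \<partial>prior y)"

lemma nn_integral_prior_likelihood:
  assumes h: "h \<in> borel_measurable (lborel_vec p)"
  shows "(\<integral>\<^sup>+ b. ennreal (likelihood \<sigma> X y b powr \<alpha>) * h b \<partial>prior y)
    = ennreal norm_const * (\<Sum>S\<in>models X. ennreal (\<pi> S) *
        (\<integral>\<^sup>+ b. ennreal (exp (- \<alpha> / (2 * \<sigma>\<^sup>2) * sqn (y - X *\<^sub>v b))) * h b \<partial>cprior y S))"
proof -
  note [measurable] = measurable_residual h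
  let ?e = "\<lambda>b. ennreal (exp (- \<alpha> / (2 * \<sigma>\<^sup>2) * sqn (y - X *\<^sub>v b)))"
  have m: "(\<lambda>b. ?e b * h b) \<in> borel_measurable (lborel_vec p)" by measurable
  have "(\<integral>\<^sup>+ b. ennreal (likelihood \<sigma> X y b powr \<alpha>) * h b \<partial>prior y)
      = (\<integral>\<^sup>+ b. ennreal norm_const * (?e b * h b) \<partial>prior y)"
    using norm_const_pos by (intro nn_integral_cong) (simp add: space_prior likelihood_powr ennreal_mult mult.assoc)
  also have "\<dots> = ennreal norm_const * (\<integral>\<^sup>+ b. ?e b * h b \<partial>prior y)"
    using m by (intro nn_integral_cmult) (simp add: measurable_prior)
  finally show ?thesis by (simp only: nn_integral_prior[OF m])
qed

lemma evidence_eq: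
  "evidence = ennreal (norm_const * (\<Sum>S\<in>models X. \<pi> S *
     (exp (- \<alpha> / (2 * \<sigma>\<^sup>2) * sqn (mres S y)) * (\<gamma> / (\<alpha> + \<gamma>)) powr (real (card S) / 2))))"
proof -
  have "evidence = ennreal norm_const * (\<Sum>S\<in>models X. ennreal (\<pi> S) *
     ennreal (exp (- \<alpha> / (2 * \<sigma>\<^sup>2) * sqn (mres S y)) * (\<gamma> / (\<alpha> + \<gamma>)) powr (real (card S) / 2)))"
    using nn_integral_prior_likelihood[of "\<lambda>_. 1"] nn_integral_conditional_prior_exp[OF _ y]
    by (simp add: evidence_def)
  also have "(\<Sum>S\<in>models X. ennreal (\<pi> S) *
     ennreal (exp (- \<alpha> / (2 * \<sigma>\<^sup>2) * sqn (mres S y)) * (\<gamma> / (\<alpha> + \<gamma>)) powr (real (card S) / 2)))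
    = ennreal (\<Sum>S\<in>models X. \<pi> S *
     (exp (- \<alpha> / (2 * \<sigma>\<^sup>2) * sqn (mres S y)) * (\<gamma> / (\<alpha> + \<gamma>)) powr (real (card S) / 2)))"
    using model_prior_pos by (simp add: less_imp_le flip: sum_ennreal ennreal_mult)
  finally show ?thesis using norm_const_pos by (simp add: ennreal_mult')
qed

lemma evidence_ge:
  assumes S: "S \<in> models X"
  shows "ennreal (norm_const * (\<pi> S * (exp (- \<alpha> / (2 * \<sigma>\<^sup>2) * sqn (mres S y)) * (\<gamma> / (\<alpha> + \<gamma>)) powr (real (card S) / 2))))
    \<le> evidence"
  unfolding evidence_eq using norm_const_pos model_prior_pos
  by (intro ennreal_leI mult_left_mono member_le_sum[OF S _ finite_models] mult_nonneg_nonneg)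
    (auto intro: less_imp_le)

lemma evidence_pos: "evidence > 0"
proof -
  have "0 < norm_const * (\<pi> {} * (exp (- \<alpha> / (2 * \<sigma>\<^sup>2) * sqn (mres {} y)) * (\<gamma> / (\<alpha> + \<gamma>)) powr (real (card {}) / 2)))"
    using norm_const_pos model_prior_pos[OF empty_model] \<alpha> \<gamma> by (intro mult_pos_pos) auto
  then show ?thesis
    using evidence_ge[OF empty_model] by (metis ennreal_less_zero_iff less_le_trans)
qed

lemma evidence_finite: "evidence < \<top>"
  by (simp add: evidence_eq)

lemma nn_integral_posterior:
  assumes h: "h \<in> borel_measurable (lborel_vec p)"
  shows "(\<integral>\<^sup>+ b. h b \<partial>posterior y) = (\<integral>\<^sup>+ b. ennreal (likelihood \<sigma> X y b powr \<alpha>) * h b \<partial>prior y) / evidence"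
proof -
  note [measurable] = measurable_likelihood_powr h
  have "(\<integral>b. likelihood \<sigma> X y b powr \<alpha> \<partial>prior y) = enn2real evidence"
    unfolding evidence_def
    by (rule integral_eq_nn_integral) (auto simp: measurable_prior)
  moreover have pos: "enn2real evidence > 0"
    using evidence_pos evidence_finite by (simp add: enn2real_positive_iff)
  ultimately have "(\<integral>\<^sup>+ b. h b \<partial>posterior y)
     = (\<integral>\<^sup>+ b. ennreal (likelihood \<sigma> X y b powr \<alpha> / enn2real evidence) * h b \<partial>prior y)"
    unfolding eb_posterior_def by (simp only:) (rule nn_integral_density; simp add: measurable_prior)
  also have "\<dots> = (\<integral>\<^sup>+ b. (ennreal (likelihood \<sigma> X y b powr \<alpha>) * h b) / evidence \<partial>prior y)"
    using pos evidence_finite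
    by (simp add: divide_ennreal[symmetric] ennreal_enn2real_if ennreal_times_divide mult.commute less_top)
  also have "\<dots> = (\<integral>\<^sup>+ b. ennreal (likelihood \<sigma> X y b powr \<alpha>) * h b \<partial>prior y) / evidence"
    by (rule nn_integral_divide) (simp add: measurable_prior)
  finally show ?thesis .
qed

lemma sets_posterior: "sets (posterior y) = sets (lborel_vec p)"
  by (simp add: eb_posterior_def sets_prior)

lemma prob_space_posterior: "prob_space (posterior y)"
proof
  have "emeasure (posterior y) (space (posterior y)) = (\<integral>\<^sup>+ b. 1 \<partial>posterior y)" by simp
  also have "\<dots> = evidence / evidence"
    by (subst nn_integral_posterior) (simp_all add: evidence_def)
  also have "\<dots> = 1" using evidence_pos evidence_finite by (simp add: ennreal_divide_self)
  finally show "emeasure (posterior y) (space (posterior y)) = 1" .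
qed

end

end

subsection \<open>Hellinger distance to a normal mixture\<close>

text \<open>A Bochner integral of a non-integrable function is 0 by convention, so the inequality
  holds without an integrability condition on \<open>f\<close> and \<open>g\<close>.\<close>

lemma hellinger_sq_le:
  assumes nonneg: "\<And>t. f t \<ge> 0" "\<And>t. g t \<ge> 0"
  shows "ennreal ((hellinger f g)\<^sup>2) \<le> (\<integral>\<^sup>+ t. ennreal ((sqrt (f t) - sqrt (g t))\<^sup>2) \<partial>lborel)"
proof -
  have nn: "(\<integral>t. (sqrt (f t) - sqrt (g t))\<^sup>2 \<partial>lborel) \<ge> 0" by simp
  then have eq: "(hellinger f g)\<^sup>2 = (\<integral>t. (sqrt (f t) - sqrt (g t))\<^sup>2 \<partial>lborel)"
    by (simp add: hellinger_def)
  show ?thesis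
  proof (cases "integrable lborel (\<lambda>t. (sqrt (f t) - sqrt (g t))\<^sup>2)")
    case True
    then show ?thesis unfolding eq by (subst nn_integral_eq_integral) auto
  next
    case False
    then show ?thesis unfolding eq by (simp add: not_integrable_integral_eq)
  qed
qed

text \<open>The geometric mean of the two densities is the normal density at the midpoint times the
  affinity \<rho>. Hence the squared distance is 2 - 2 \<rho>, and 1 - exp (- x) \<le> x
  finishes.\<close>

lemma nn_integral_normal_hellinger:
  assumes \<sigma>: "\<sigma> > 0"
  shows "(\<integral>\<^sup>+ t. ennreal ((sqrt (normal_density m1 \<sigma> t) - sqrt (normal_density m2 \<sigma> t))\<^sup>2) \<partial>lborel)
    \<le> ennreal ((m1 - m2)\<^sup>2 / (4 * \<sigma>\<^sup>2))"
proof -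
  let ?\<rho> = "exp (- (m1 - m2)\<^sup>2 / (8 * \<sigma>\<^sup>2))"
  have affinity: "sqrt (normal_density m1 \<sigma> t) * sqrt (normal_density m2 \<sigma> t)
      = ?\<rho> * normal_density ((m1 + m2) / 2) \<sigma> t" for t
  proof -
    have "normal_density m1 \<sigma> t * normal_density m2 \<sigma> t = (?\<rho> * normal_density ((m1 + m2) / 2) \<sigma> t)\<^sup>2"
    proof -
      have "- (t - m1)\<^sup>2 / (2 * \<sigma>\<^sup>2) + - (t - m2)\<^sup>2 / (2 * \<sigma>\<^sup>2)
        = 2 * (- (m1 - m2)\<^sup>2 / (8 * \<sigma>\<^sup>2)) + 2 * (- (t - (m1 + m2) / 2)\<^sup>2 / (2 * \<sigma>\<^sup>2))"
        using \<sigma> by (simp add: field_simps power2_eq_square)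
      then show ?thesis
        unfolding normal_density_def power_mult_distrib exp_of_nat_mult[of 2, symmetric, simplified]
        by (simp add: power_divide exp_double[symmetric] mult_exp_exp exp_add[symmetric]) 
    qed
    then show ?thesis by (simp add: real_sqrt_mult[symmetric] normal_density_nonneg)
  qed
  have "(sqrt (normal_density m1 \<sigma> t) - sqrt (normal_density m2 \<sigma> t))\<^sup>2
      = normal_density m1 \<sigma> t + normal_density m2 \<sigma> t - 2 * ?\<rho> * normal_density ((m1 + m2) / 2) \<sigma> t" for t
    using affinity[of t] by (simp add: power2_diff normal_density_nonneg mult.assoc)
  then have "(\<integral>\<^sup>+ t. ennreal ((sqrt (normal_density m1 \<sigma> t) - sqrt (normal_density m2 \<sigma> t))\<^sup>2) \<partial>lborel)
     = (\<integral>\<^sup>+ t. ennreal (normal_density m1 \<sigma> t + normal_density m2 \<sigma> t - 2 * ?\<rho> * normal_density ((m1 + m2) / 2) \<sigma> t) \<partial>lborel)"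
    by simp
  also have "\<dots> = ennreal (\<integral>t. normal_density m1 \<sigma> t + normal_density m2 \<sigma> t - 2 * ?\<rho> * normal_density ((m1 + m2) / 2) \<sigma> t \<partial>lborel)"
  proof (rule nn_integral_eq_integral)
    show "AE t in lborel. 0 \<le> normal_density m1 \<sigma> t + normal_density m2 \<sigma> t - 2 * ?\<rho> * normal_density ((m1 + m2) / 2) \<sigma> t"
      using \<open>\<And>t. (sqrt (normal_density m1 \<sigma> t) - sqrt (normal_density m2 \<sigma> t))\<^sup>2 = _ t\<close>
      by (metis (no_types, lifting) AE_I2 zero_le_power2)
  qed (use \<sigma> in \<open>intro Bochner_Integration.integrable_add Bochner_Integration.integrable_diff integrable_mult_right integrable_normal_density\<close>)
  also have "(\<integral>t. normal_density m1 \<sigma> t + normal_density m2 \<sigma> t - 2 * ?\<rho> * normal_density ((m1 + m2) / 2) \<sigma> t \<partial>lborel) = 2 - 2 * ?\<rho>"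
    using \<sigma> by simp
  also have "2 - 2 * ?\<rho> \<le> (m1 - m2)\<^sup>2 / (4 * \<sigma>\<^sup>2)"
    using exp_ge_add_one_self[of "- (m1 - m2)\<^sup>2 / (8 * \<sigma>\<^sup>2)"] by simp
  finally show ?thesis by (simp add: ennreal_leI)
qed

text \<open>Convexity at a single point: after expanding the square only the cross term is nonlinear
  in \<open>h\<close>, and E sqrt h \<le> sqrt (E h) is nonnegativity of the variance of sqrt h. The
  bound \<open>B\<close> supplies integrability.\<close>

lemma (in prob_space) sqrt_mixture_diff_le:
  assumes h: "h \<in> borel_measurable M" "\<And>x. 0 \<le> h x" "\<And>x. h x \<le> B" and f: "f \<ge> 0"
  shows "ennreal ((sqrt f - sqrt (\<integral>x. h x \<partial>M))\<^sup>2) \<le> (\<integral>\<^sup>+ x. ennreal ((sqrt f - sqrt (h x))\<^sup>2) \<partial>M)"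
proof -
  note [measurable] = h(1)
  let ?g = "\<integral>x. h x \<partial>M"
  have int: "integrable M h"
    using h by (intro integrable_const_bound[where B=B]) auto
  have int_sqrt: "integrable M (\<lambda>x. sqrt (h x))"
    using h by (intro integrable_const_bound[where B="sqrt B"]) auto
  have g: "?g \<ge> 0" using h(2) by simp
  have "(\<integral>x. sqrt (h x) \<partial>M)\<^sup>2 \<le> ?g"
    using variance_positive[of "\<lambda>x. sqrt (h x)"] variance_eq[OF int_sqrt] int h(2) by simp
  then have jensen: "(\<integral>x. sqrt (h x) \<partial>M) \<le> sqrt ?g"
    by (rule real_le_rsqrt)
  have int2: "integrable M (\<lambda>x. f + h x - 2 * sqrt f * sqrt (h x))"
    using int int_sqrt by auto
  have eq: "(sqrt f - sqrt (h x))\<^sup>2 = f + h x - 2 * sqrt f * sqrt (h x)" for x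
    using f h(2)[of x] by (simp add: power2_diff)
  have "(sqrt f - sqrt ?g)\<^sup>2 = f + ?g - 2 * sqrt f * sqrt ?g"
    using f g by (simp add: power2_diff)
  also have "\<dots> \<le> f + ?g - 2 * sqrt f * (\<integral>x. sqrt (h x) \<partial>M)"
    using jensen f by (intro diff_left_mono mult_left_mono) auto
  also have "\<dots> = (\<integral>x. f + h x - 2 * sqrt f * sqrt (h x) \<partial>M)"
    using int int_sqrt by (simp add: prob_space)
  finally have "ennreal ((sqrt f - sqrt ?g)\<^sup>2) \<le> ennreal (\<integral>x. f + h x - 2 * sqrt f * sqrt (h x) \<partial>M)"
    by (rule ennreal_leI)
  also have "\<dots> = (\<integral>\<^sup>+ x. ennreal (f + h x - 2 * sqrt f * sqrt (h x)) \<partial>M)"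
    by (rule nn_integral_eq_integral[OF int2, symmetric]) (simp flip: eq)
  finally show ?thesis by (simp only: eq)
qed

text \<open>Pointwise convexity in \<open>t\<close>, then Tonelli, then the bound for two normal
  densities. The common variance bounds all component densities uniformly.\<close>

lemma (in prob_space) hellinger_normal_mixture_le:
  assumes \<sigma>: "\<sigma> > 0" and m: "m \<in> borel_measurable M"
  shows "ennreal ((hellinger (normal_density m0 \<sigma>) (\<lambda>t. \<integral>x. normal_density (m x) \<sigma> t \<partial>M))\<^sup>2)
    \<le> (\<integral>\<^sup>+ x. ennreal ((m0 - m x)\<^sup>2 / (4 * \<sigma>\<^sup>2)) \<partial>M)"
proof -
  note [measurable] = m
  interpret PL: pair_sigma_finite M lborel ..
  let ?d = "\<lambda>x t. ennreal ((sqrt (normal_density m0 \<sigma> t) - sqrt (normal_density (m x) \<sigma> t))\<^sup>2)"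
  have bound: "normal_density m' \<sigma> t \<le> 1 / sqrt (2 * pi * \<sigma>\<^sup>2)" for m' t
    using \<sigma> by (simp add: normal_density_def mult_left_le divide_right_mono)
  have "ennreal ((hellinger (normal_density m0 \<sigma>) (\<lambda>t. \<integral>x. normal_density (m x) \<sigma> t \<partial>M))\<^sup>2)
      \<le> (\<integral>\<^sup>+ t. ennreal ((sqrt (normal_density m0 \<sigma> t) - sqrt (\<integral>x. normal_density (m x) \<sigma> t \<partial>M))\<^sup>2) \<partial>lborel)"
    by (rule hellinger_sq_le) (auto simp: normal_density_nonneg)
  also have "\<dots> \<le> (\<integral>\<^sup>+ t. \<integral>\<^sup>+ x. ?d x t \<partial>M \<partial>lborel)"
  proof (rule nn_integral_mono)
    fix t
    have "(\<lambda>x. normal_density (m x) \<sigma> t) \<in> borel_measurable M"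
      unfolding normal_density_def by measurable
    then show "ennreal ((sqrt (normal_density m0 \<sigma> t) - sqrt (\<integral>x. normal_density (m x) \<sigma> t \<partial>M))\<^sup>2) \<le> (\<integral>\<^sup>+ x. ?d x t \<partial>M)"
      by (rule sqrt_mixture_diff_le[OF _ _ bound]) (auto simp: normal_density_nonneg)
  qed
  also have "\<dots> = (\<integral>\<^sup>+ x. \<integral>\<^sup>+ t. ?d x t \<partial>lborel \<partial>M)"
    by (rule PL.Fubini') (unfold normal_density_def, measurable)
  also have "\<dots> \<le> (\<integral>\<^sup>+ x. ennreal ((m0 - m x)\<^sup>2 / (4 * \<sigma>\<^sup>2)) \<partial>M)"
    by (intro nn_integral_mono nn_integral_normal_hellinger \<sigma>)
  finally show ?thesis .
qed

subsection \<open>Predictive risk\<close>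

lemma add_diff_cancel_vec:
  fixes u v :: "'a :: ab_group_add Matrix.vec"
  assumes "u \<in> carrier_vec n" and "v \<in> carrier_vec n"
  shows "u + v - u = v" and "u + (v - u) = v"
  using carrier_vecD[OF assms(1)] carrier_vecD[OF assms(2)] by (auto intro!: eq_vecI)

context eb_regression
begin

text \<open>Averaging over the rows of the design turns squared differences of predicted means into
  the in-sample squared norm, on which the posterior can be controlled.\<close>

lemma hellinger_risk_le:
  assumes \<beta>: "\<beta> \<in> carrier_vec p" and y: "y \<in> carrier_vec n" and n: "n > 0"
  shows "ennreal (\<integral>x. (hellinger (true_density \<sigma> \<beta> x) (predictive_density \<sigma> a c \<gamma> \<alpha> X y x))\<^sup>2
      \<partial>measure_pmf (empirical_rows X))
    \<le> (\<integral>\<^sup>+ b. ennreal (sqn (X *\<^sub>v b - X *\<^sub>v \<beta>) / (4 * \<sigma>\<^sup>2 * real n)) \<partial>posterior y)"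
proof -
  interpret P: prob_space "posterior y" by (rule prob_space_posterior[OF y])
  let ?H = "\<lambda>x. (hellinger (true_density \<sigma> \<beta> x) (predictive_density \<sigma> a c \<gamma> \<alpha> X y x))\<^sup>2"
  let ?r = "\<lambda>i. Matrix.row X i"
  let ?q = "\<lambda>i b. (scalar_prod (?r i) \<beta> - scalar_prod (?r i) b)\<^sup>2 / (4 * \<sigma>\<^sup>2)"
  have dim: "dim_row X = n" using X by simp
  have row: "?r i \<in> carrier_vec p" if "i < n" for i using X that by simp
  have meas: "(\<lambda>b. scalar_prod (?r i) b) \<in> borel_measurable (posterior y)" if "i < n" for i
    using measurable_scalar_prod[OF measurable_const_vec[OF row[OF that]] measurable_id_vec]
    by (simp add: measurable_cong_sets[OF sets_posterior[OF y] refl])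
  have H: "ennreal (?H (?r i)) \<le> (\<integral>\<^sup>+ b. ennreal (?q i b) \<partial>posterior y)" if i: "i < n" for i
  proof -
    have "true_density \<sigma> \<beta> (?r i) = normal_density (scalar_prod (?r i) \<beta>) \<sigma>"
      "predictive_density \<sigma> a c \<gamma> \<alpha> X y (?r i) = (\<lambda>t. \<integral>b. normal_density (scalar_prod (?r i) b) \<sigma> t \<partial>posterior y)"
      by (auto simp: true_density_def predictive_density_def)
    then show ?thesis using P.hellinger_normal_mixture_le[OF \<sigma> meas[OF i]] by simp
  qed
  have "(\<integral>x. ?H x \<partial>measure_pmf (empirical_rows X)) = (\<Sum>i<n. 1 / real n * ?H (?r i))"
    using n by (simp add: empirical_rows_def dim integral_pmf_of_set sum_divide_distrib lessThan_empty_iff)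
  then have "ennreal (\<integral>x. ?H x \<partial>measure_pmf (empirical_rows X)) = ennreal (\<Sum>i<n. 1 / real n * ?H (?r i))"
    by (simp only:)
  also have "\<dots> = (\<Sum>i<n. ennreal (1 / real n * ?H (?r i)))"
    by (rule sum_ennreal[symmetric]) simp
  also have "\<dots> = (\<Sum>i<n. ennreal (1 / real n) * ennreal (?H (?r i)))"
    by (intro sum.cong refl ennreal_mult) auto
  also have "\<dots> \<le> (\<Sum>i<n. ennreal (1 / real n) * (\<integral>\<^sup>+ b. ennreal (?q i b) \<partial>posterior y))"
    by (intro sum_mono mult_left_mono H) auto
  also have "\<dots> = (\<Sum>i<n. \<integral>\<^sup>+ b. ennreal (1 / real n) * ennreal (?q i b) \<partial>posterior y)"
  proof (rule sum.cong[OF refl])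
    fix i assume "i \<in> {..<n}"
    then have [measurable]: "(\<lambda>b. scalar_prod (?r i) b) \<in> borel_measurable (posterior y)" using meas by simp
    show "ennreal (1 / real n) * (\<integral>\<^sup>+ b. ennreal (?q i b) \<partial>posterior y)
      = (\<integral>\<^sup>+ b. ennreal (1 / real n) * ennreal (?q i b) \<partial>posterior y)"
      by (rule nn_integral_cmult[symmetric]) measurable
  qed
  also have "\<dots> = (\<integral>\<^sup>+ b. (\<Sum>i<n. ennreal (1 / real n) * ennreal (?q i b)) \<partial>posterior y)"
  proof (rule nn_integral_sum[symmetric])
    fix i assume "i \<in> {..<n}"
    then have [measurable]: "(\<lambda>b. scalar_prod (?r i) b) \<in> borel_measurable (posterior y)" using meas by simp
    show "(\<lambda>b. ennreal (1 / real n) * ennreal (?q i b)) \<in> borel_measurable (posterior y)" by measurable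
  qed
  also have "\<dots> = (\<integral>\<^sup>+ b. ennreal (sqn (X *\<^sub>v b - X *\<^sub>v \<beta>) / (4 * \<sigma>\<^sup>2 * real n)) \<partial>posterior y)"
  proof (rule nn_integral_cong)
    fix b assume "b \<in> space (posterior y)"
    have "sqn (X *\<^sub>v b - X *\<^sub>v \<beta>) = (\<Sum>i<n. (scalar_prod (?r i) \<beta> - scalar_prod (?r i) b)\<^sup>2)"
      using dim by (auto simp: scalar_prod_def[of "X *\<^sub>v b - X *\<^sub>v \<beta>"] atLeast0LessThan power2_eq_square algebra_simps intro!: sum.cong)
    then have "(\<Sum>i<n. 1 / real n * ?q i b) = sqn (X *\<^sub>v b - X *\<^sub>v \<beta>) / (4 * \<sigma>\<^sup>2 * real n)"
      by (simp add: sum_divide_distrib[symmetric] mult_ac)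
    then show "(\<Sum>i<n. ennreal (1 / real n) * ennreal (?q i b)) = ennreal (sqn (X *\<^sub>v b - X *\<^sub>v \<beta>) / (4 * \<sigma>\<^sup>2 * real n))"
      by (simp add: sum_ennreal flip: ennreal_mult)
  qed
  finally show ?thesis .
qed

section \<open>Exponential moment of the in-sample prediction error\<close>

definition shrink :: "nat set \<Rightarrow> real" where
  "shrink S = (\<gamma> / (\<alpha> + \<gamma>)) powr (real (card S) / 2)"

lemma shrink_pos: "shrink S > 0"
  using \<alpha> \<gamma> by (simp add: shrink_def)

text \<open>For data \<open>y = \<mu> + z\<close>, the contribution of \<open>S\<close> to the numerator of the posterior expectation of
  \<open>exp (\<eta> * sqn (X b - \<mu>) / \<sigma>\<^sup>2)\<close> is at most a multiple of
  \<open>\<pi> S * exp (- \<alpha> * sqn z / (2 * \<sigma>\<^sup>2)) * exp (excess \<eta> \<mu> S z)\<close>; the factor in \<open>sqn z\<close> cancels against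
  the denominator.\<close>

definition excess :: "real \<Rightarrow> real Matrix.vec \<Rightarrow> nat set \<Rightarrow> real Matrix.vec \<Rightarrow> real" where
  "excess \<eta> \<mu> S z = (\<alpha> + 4 * \<eta>) / (2 * \<sigma>\<^sup>2) * sqn (mfit S z)
     - \<alpha> / \<sigma>\<^sup>2 * scalar_prod (mres S \<mu>) z + (4 * \<eta> - \<alpha>) / (2 * \<sigma>\<^sup>2) * sqn (mres S \<mu>)"

lemma posterior_exp_moment:
  assumes \<beta>: "\<beta> \<in> carrier_vec p" and S0: "support_vec \<beta> \<in> models X" and z: "z \<in> carrier_vec n"
    and \<eta>: "0 \<le> \<eta>" "4 * \<eta> \<le> \<alpha>"
  shows "(\<integral>\<^sup>+ b. ennreal (exp (\<eta> / \<sigma>\<^sup>2 * sqn (X *\<^sub>v b - X *\<^sub>v \<beta>))) \<partial>posterior (X *\<^sub>v \<beta> + z))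
    \<le> ennreal (\<Sum>S\<in>models X. \<pi> S / (\<pi> (support_vec \<beta>) * shrink (support_vec \<beta>)) * exp (excess \<eta> (X *\<^sub>v \<beta>) S z))"
proof -
  let ?\<mu> = "X *\<^sub>v \<beta>" and ?y = "X *\<^sub>v \<beta> + z" and ?S0 = "support_vec \<beta>"
  let ?Ez = "exp (- \<alpha> / (2 * \<sigma>\<^sup>2) * sqn z)"
  let ?h = "\<lambda>b. ennreal (exp (\<eta> / \<sigma>\<^sup>2 * sqn (X *\<^sub>v b - ?\<mu>)))"
  let ?N = "norm_const * ?Ez * (\<Sum>S\<in>models X. \<pi> S * exp (excess \<eta> ?\<mu> S z))"
  let ?D = "norm_const * ?Ez * (\<pi> ?S0 * shrink ?S0)"
  have \<mu>: "?\<mu> \<in> carrier_vec n" using X \<beta> by simp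
  have y: "?y \<in> carrier_vec n" using \<mu> z by simp
  note nc = norm_const_pos[OF y]
  have h: "?h \<in> borel_measurable (lborel_vec p)"
  proof -
    have [measurable]: "(\<lambda>b. sqn (X *\<^sub>v b - ?\<mu>)) \<in> borel_measurable (lborel_vec p)"
      by (intro measurable_scalar_prod[where k=n] measurable_minus_vec measurable_const_vec \<mu>
          measurable_mult_mat_vec[OF _ X] measurable_id_vec)
    show ?thesis by measurable
  qed
  have num: "(\<integral>\<^sup>+ b. ennreal (exp (- \<alpha> / (2 * \<sigma>\<^sup>2) * sqn (?y - X *\<^sub>v b))) * ?h b \<partial>cprior ?y S)
      \<le> ennreal (?Ez * exp (excess \<eta> ?\<mu> S z))" if S: "S \<in> models X" for S
  proof -
    interpret D: linear_design n "card S" "columns_mat X S" by (rule linear_design_columns[OF S])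
    have "2 * \<eta> / \<sigma>\<^sup>2 * sqn (mfit S ?y - ?\<mu>) - \<alpha> / (2 * \<sigma>\<^sup>2) * sqn (mres S ?y)
        = - \<alpha> / (2 * \<sigma>\<^sup>2) * sqn z + excess \<eta> ?\<mu> S z"
      unfolding D.sqn_fit_error[OF \<mu> z] D.sqn_residual[OF \<mu> z] excess_def
      using \<sigma> by (simp add: field_simps)
    then have "ennreal (exp (2 * \<eta> / \<sigma>\<^sup>2 * sqn (mfit S ?y - ?\<mu>) - \<alpha> / (2 * \<sigma>\<^sup>2) * sqn (mres S ?y)))
        = ennreal (?Ez * exp (excess \<eta> ?\<mu> S z))"
      by (simp only: exp_add)
    moreover have "(\<integral>\<^sup>+ b. ennreal (exp (- \<alpha> / (2 * \<sigma>\<^sup>2) * sqn (?y - X *\<^sub>v b))) * ?h b \<partial>cprior ?y S)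
      = (\<integral>\<^sup>+ b. ennreal (exp (\<eta> / \<sigma>\<^sup>2 * sqn (X *\<^sub>v b - ?\<mu>)) * exp (- \<alpha> / (2 * \<sigma>\<^sup>2) * sqn (?y - X *\<^sub>v b))) \<partial>cprior ?y S)"
      by (intro nn_integral_cong) (simp add: ennreal_mult mult.commute)
    ultimately show ?thesis
      using nn_integral_conditional_prior_exp_risk[OF S y \<mu> \<eta>] by simp
  qed
  have "(\<integral>\<^sup>+ b. ennreal (likelihood \<sigma> X ?y b powr \<alpha>) * ?h b \<partial>prior ?y)
      \<le> ennreal norm_const * (\<Sum>S\<in>models X. ennreal (\<pi> S) * ennreal (?Ez * exp (excess \<eta> ?\<mu> S z)))"
    unfolding nn_integral_prior_likelihood[OF y h]
    by (intro mult_left_mono sum_mono num) auto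
  also have "\<dots> = ennreal ?N"
  proof -
    have "(\<Sum>S\<in>models X. ennreal (\<pi> S) * ennreal (?Ez * exp (excess \<eta> ?\<mu> S z)))
        = ennreal (\<Sum>S\<in>models X. \<pi> S * (?Ez * exp (excess \<eta> ?\<mu> S z)))"
      using model_prior_pos by (simp add: less_imp_le ennreal_mult flip: sum_ennreal)
    also have "(\<Sum>S\<in>models X. \<pi> S * (?Ez * exp (excess \<eta> ?\<mu> S z))) = ?Ez * (\<Sum>S\<in>models X. \<pi> S * exp (excess \<eta> ?\<mu> S z))"
      by (simp add: sum_distrib_left mult_ac)
    finally show ?thesis using nc by (simp add: mult.assoc flip: ennreal_mult')
  qed
  finally have N: "(\<integral>\<^sup>+ b. ennreal (likelihood \<sigma> X ?y b powr \<alpha>) * ?h b \<partial>prior ?y) \<le> ennreal ?N" .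
  \<comment> \<open>The true mean lies in the column space of the true support, so least squares
    there leaves a residual no larger than \<open>z\<close> itself. This is what makes the factor
    \<open>?Ez\<close> common to numerator and denominator.\<close>
  have D: "ennreal ?D \<le> evidence ?y"
  proof -
    interpret D: linear_design n "card ?S0" "columns_mat X ?S0" by (rule linear_design_columns[OF S0])
    obtain b0 where b0: "b0 \<in> carrier_vec (card ?S0)" "insert_zeros p ?S0 b0 = \<beta>"
      by (rule insert_zeros_support[OF \<beta>])
    have "?\<mu> = columns_mat X ?S0 *\<^sub>v b0"
      using mult_insert_zeros[OF X models_subset[OF S0] b0(1)] b0(2) by simp
    moreover have "?y - ?\<mu> = z" by (rule add_diff_cancel_vec[OF \<mu> z])
    ultimately have "sqn (mres ?S0 ?y) \<le> sqn z"
      using D.sqn_residual_minimal[OF y b0(1)] by simp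
    then have "- \<alpha> / (2 * \<sigma>\<^sup>2) * sqn z \<le> - \<alpha> / (2 * \<sigma>\<^sup>2) * sqn (mres ?S0 ?y)"
      using \<alpha> \<sigma> by (intro mult_left_mono_neg) auto
    then have "?D \<le> norm_const * (\<pi> ?S0 * (exp (- \<alpha> / (2 * \<sigma>\<^sup>2) * sqn (mres ?S0 ?y)) * shrink ?S0))"
      using nc model_prior_pos[OF S0] shrink_pos[of ?S0] by (simp add: mult_ac mult_left_mono)
    also have "ennreal \<dots> \<le> evidence ?y"
      unfolding shrink_def by (rule evidence_ge[OF y S0])
    finally show ?thesis by (simp add: ennreal_leI)
  qed
  have Dpos: "?D > 0" using nc model_prior_pos[OF S0] shrink_pos[of ?S0] by simp
  define d where "d = enn2real (evidence ?y)"
  have ev: "evidence ?y = ennreal d" using evidence_finite[OF y] by (simp add: d_def less_top)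
  then have dD: "?D \<le> d" using D Dpos by (simp add: ennreal_le_iff2)
  have sum_nonneg: "0 \<le> (\<Sum>S\<in>models X. \<pi> S * exp (excess \<eta> ?\<mu> S z))"
    using model_prior_pos by (intro sum_nonneg) (simp add: less_imp_le)
  have "(\<integral>\<^sup>+ b. ?h b \<partial>posterior ?y) \<le> ennreal ?N / ennreal d"
    unfolding nn_integral_posterior[OF y h] ev by (rule divide_right_mono_ennreal[OF N])
  also have "\<dots> = ennreal (?N / d)"
    using dD Dpos nc sum_nonneg by (intro divide_ennreal) auto
  also have "\<dots> \<le> ennreal (?N / ?D)"
    using dD Dpos nc sum_nonneg by (intro ennreal_leI divide_left_mono) auto
  also have "?N / ?D = (\<Sum>S\<in>models X. \<pi> S * exp (excess \<eta> ?\<mu> S z)) / (\<pi> ?S0 * shrink ?S0)"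
    using nc by simp
  also have "\<dots> = (\<Sum>S\<in>models X. \<pi> S / (\<pi> ?S0 * shrink ?S0) * exp (excess \<eta> ?\<mu> S z))"
    by (simp add: sum_divide_distrib)
  finally show ?thesis .
qed

lemma measurable_excess:
  assumes S: "S \<in> models X" and \<mu>: "\<mu> \<in> carrier_vec n"
  shows "excess \<eta> \<mu> S \<in> borel_measurable (lborel_vec n)"
proof -
  interpret D: linear_design n "card S" "columns_mat X S" by (rule linear_design_columns[OF S])
  have [measurable]: "(\<lambda>z. sqn (D.fit z)) \<in> borel_measurable (lborel_vec n)"
    by (intro measurable_scalar_prod[where k=n] D.measurable_fit measurable_id_vec)
  have [measurable]: "(\<lambda>z. scalar_prod (mres S \<mu>) z) \<in> borel_measurable (lborel_vec n)"
    using \<mu> D.fit_carrier[OF \<mu>] by (intro measurable_scalar_prod[where k=n] measurable_const_vec measurable_id_vec) simp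
  show ?thesis unfolding excess_def[abs_def] by measurable
qed

text \<open>The bias direction is orthogonal to the column space, so its moment generating function
  separates from that of the projected noise. It contributes \<alpha>^2 against 4 \<eta> - \<alpha>
  (both times |m|^2 / (2 \<sigma>^2), with m the bias), and the hypothesis on \<eta> makes the sum
  nonpositive. Only the dimension factor survives, uniformly in \<mu>.\<close>

lemma expectation_excess:
  assumes S: "S \<in> models X" and \<mu>: "\<mu> \<in> carrier_vec n"
    and \<eta>: "0 \<le> \<eta>" "4 * \<eta> \<le> \<alpha> * (1 - \<alpha>)"
  shows "(\<integral>\<^sup>+ z. ennreal (exp (excess \<eta> \<mu> S z)) \<partial>mvn (0\<^sub>v n) (\<sigma>\<^sup>2 \<cdot>\<^sub>m 1\<^sub>m n))
    \<le> ennreal ((1 - (\<alpha> + 4 * \<eta>)) powr (- real (card S) / 2))"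
proof -
  interpret D: linear_design n "card S" "columns_mat X S" by (rule linear_design_columns[OF S])
  interpret N: gaussian_precision n "(1 / \<sigma>\<^sup>2) \<cdot>\<^sub>m 1\<^sub>m n" "\<sigma>\<^sup>2 \<cdot>\<^sub>m 1\<^sub>m n"
    using \<sigma> by (intro gaussian_precision_isotropic) simp
  let ?N = "mvn (0\<^sub>v n) (\<sigma>\<^sup>2 \<cdot>\<^sub>m 1\<^sub>m n)"
  let ?m = "mres S \<mu>" and ?b = "(- \<alpha> / \<sigma>\<^sup>2) \<cdot>\<^sub>v mres S \<mu>"
  let ?\<tau> = "\<alpha> + 4 * \<eta>" and ?k = "(4 * \<eta> - \<alpha>) / (2 * \<sigma>\<^sup>2) * sqn (mres S \<mu>)"
  have m: "?m \<in> carrier_vec n" using \<mu> D.fit_carrier[OF \<mu>] by simp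
  have b: "?b \<in> carrier_vec n" using m by simp
  \<comment> \<open>The same condition on \<eta> also keeps \<alpha> + 4 \<eta> below 1, as the
    moment of the projected noise requires.\<close>
  have "\<alpha> * (1 - \<alpha>) < 1 * (1 - \<alpha>)" using \<alpha> by (intro mult_strict_right_mono) auto
  with \<eta>(2) have "4 * \<eta> < 1 * (1 - \<alpha>)" by (rule le_less_trans)
  then have \<tau>: "0 \<le> ?\<tau>" "?\<tau> < 1" using \<eta>(1) \<alpha> by simp_all
  have orth: "scalar_prod ?b (columns_mat X S *\<^sub>v u) = 0" if "u \<in> carrier_vec (card S)" for u
    using D.fit_orthogonal[OF \<mu> that] m D.W_mult[OF that] by simp
  have meas: "(\<lambda>z. ennreal (exp (?\<tau> / (2 * \<sigma>\<^sup>2) * sqn (D.fit z) + scalar_prod ?b z))) \<in> borel_measurable ?N"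
  proof -
    have [measurable]: "(\<lambda>z. sqn (D.fit z)) \<in> borel_measurable (lborel_vec n)"
      "(\<lambda>z. scalar_prod ?b z) \<in> borel_measurable (lborel_vec n)"
      by (intro measurable_scalar_prod[where k=n] D.measurable_fit measurable_const_vec[OF b] measurable_id_vec)+
    show ?thesis unfolding N.measurable_mvn[OF zero_carrier_vec] by measurable
  qed
  have "(\<integral>\<^sup>+ z. ennreal (exp (excess \<eta> \<mu> S z)) \<partial>?N)
      = (\<integral>\<^sup>+ z. ennreal (exp ?k) * ennreal (exp (?\<tau> / (2 * \<sigma>\<^sup>2) * sqn (D.fit z) + scalar_prod ?b z)) \<partial>?N)"
  proof (rule nn_integral_cong)
    fix z assume "z \<in> space ?N"
    then have z: "z \<in> carrier_vec n" by (simp add: N.space_mvn)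
    have "scalar_prod ?b z = - \<alpha> / \<sigma>\<^sup>2 * scalar_prod ?m z"
      using carrier_vecD[OF m] carrier_vecD[OF z] by (intro scalar_prod_smult_left) (simp only:)
    then have "excess \<eta> \<mu> S z = ?k + (?\<tau> / (2 * \<sigma>\<^sup>2) * sqn (D.fit z) + scalar_prod ?b z)"
      by (simp add: excess_def)
    then show "ennreal (exp (excess \<eta> \<mu> S z))
      = ennreal (exp ?k) * ennreal (exp (?\<tau> / (2 * \<sigma>\<^sup>2) * sqn (D.fit z) + scalar_prod ?b z))"
      by (simp only: exp_add[of ?k]) (simp add: ennreal_mult)
  qed
  also have "\<dots> = ennreal (exp ?k) * (\<integral>\<^sup>+ z. ennreal (exp (?\<tau> / (2 * \<sigma>\<^sup>2) * sqn (D.fit z) + scalar_prod ?b z)) \<partial>?N)"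
    by (rule nn_integral_cmult[OF meas])
  also have "\<dots> = ennreal (exp ?k) * ennreal ((1 - ?\<tau>) powr (- real (card S) / 2) * exp (\<sigma>\<^sup>2 * sqn ?b / 2))"
    by (simp only: D.nn_integral_exp_fit[OF \<sigma> \<tau> b orth])
  also have "\<dots> = ennreal ((1 - ?\<tau>) powr (- real (card S) / 2) * exp (?k + \<sigma>\<^sup>2 * sqn ?b / 2))"
    by (simp add: exp_add mult_ac flip: ennreal_mult)
  also have "\<dots> \<le> ennreal ((1 - ?\<tau>) powr (- real (card S) / 2) * 1)"
  proof (intro ennreal_leI mult_left_mono)
    have "sqn ?b = (\<alpha> / \<sigma>\<^sup>2)\<^sup>2 * sqn ?m" using m by (simp add: power2_eq_square)
    then have "?k + \<sigma>\<^sup>2 * sqn ?b / 2 = (4 * \<eta> - \<alpha> * (1 - \<alpha>)) / (2 * \<sigma>\<^sup>2) * sqn ?m"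
      using \<sigma> by (simp add: field_simps power2_eq_square)
    also have "\<dots> \<le> 0"
      using \<eta> \<sigma> sqn_nonneg[of ?m] by (intro mult_nonpos_nonneg divide_nonpos_pos) auto
    finally show "exp (?k + \<sigma>\<^sup>2 * sqn ?b / 2) \<le> 1" by simp
  qed simp
  finally show ?thesis by simp
qed

text \<open>The truncation level \<open>T\<close> stays free: the remainder is discounted by exp (-
  \<eta> T), to be balanced later against the sum over models.\<close>

lemma predictive_risk_le:
  assumes \<beta>: "\<beta> \<in> carrier_vec p" and S0: "support_vec \<beta> \<in> models X" and n: "n > 0"
    and \<eta>: "0 < \<eta>" "4 * \<eta> \<le> \<alpha> * (1 - \<alpha>)" and T: "T \<ge> 0"
  shows "(\<integral>\<^sup>+ y. ennreal (\<integral>x. (hellinger (true_density \<sigma> \<beta> x) (predictive_density \<sigma> a c \<gamma> \<alpha> X y x))\<^sup>2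
      \<partial>measure_pmf (empirical_rows X)) \<partial>data_law \<sigma> X \<beta>)
    \<le> ennreal (1 / (4 * real n) * (T + exp (- \<eta> * T) / \<eta> *
        (\<Sum>S\<in>models X. \<pi> S / (\<pi> (support_vec \<beta>) * shrink (support_vec \<beta>)) *
           (1 - (\<alpha> + 4 * \<eta>)) powr (- real (card S) / 2))))"
proof -
  interpret N: gaussian_precision n "(1 / \<sigma>\<^sup>2) \<cdot>\<^sub>m 1\<^sub>m n" "\<sigma>\<^sup>2 \<cdot>\<^sub>m 1\<^sub>m n"
    using \<sigma> by (intro gaussian_precision_isotropic) simp
  let ?N = "mvn (0\<^sub>v n) (\<sigma>\<^sup>2 \<cdot>\<^sub>m 1\<^sub>m n)"
  interpret PN: prob_space ?N by (rule N.prob_space_mvn) simp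
  let ?\<mu> = "X *\<^sub>v \<beta>" and ?S0 = "support_vec \<beta>"
  let ?w = "\<lambda>S. \<pi> S / (\<pi> ?S0 * shrink ?S0)"
  let ?E = "\<lambda>z. \<Sum>S\<in>models X. ?w S * exp (excess \<eta> ?\<mu> S z)"
  let ?K = "exp (- \<eta> * T) / (4 * real n * \<eta>)"
  let ?U = "\<lambda>z. ennreal (T / (4 * real n)) + ennreal ?K * ennreal (?E z)"
  have \<mu>: "?\<mu> \<in> carrier_vec n" using X \<beta> by simp
  have w: "?w S \<ge> 0" if "S \<in> models X" for S
    using model_prior_pos[OF that] model_prior_pos[OF S0] shrink_pos[of ?S0] by simp
  have "\<alpha> * (1 - \<alpha>) \<le> \<alpha>" using \<alpha> by (simp add: mult_left_le)
  then have \<eta>': "4 * \<eta> \<le> \<alpha>" using \<eta> by simp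
  have K: "?K \<ge> 0" using \<eta> by simp
  have pointwise: "ennreal (\<integral>x. (hellinger (true_density \<sigma> \<beta> x) (predictive_density \<sigma> a c \<gamma> \<alpha> X (?\<mu> + z) x))\<^sup>2
      \<partial>measure_pmf (empirical_rows X)) \<le> ?U z" if z: "z \<in> carrier_vec n" for z
  proof -
    have y: "?\<mu> + z \<in> carrier_vec n" using \<mu> z by simp
    interpret P: prob_space "posterior (?\<mu> + z)" by (rule prob_space_posterior[OF y])
    let ?g = "\<lambda>b. exp (\<eta> / \<sigma>\<^sup>2 * sqn (X *\<^sub>v b - ?\<mu>))"
    have [measurable]: "(\<lambda>b. sqn (X *\<^sub>v b - ?\<mu>)) \<in> borel_measurable (lborel_vec p)"
      by (intro measurable_scalar_prod[where k=n] measurable_minus_vec measurable_const_vec \<mu>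
          measurable_mult_mat_vec[OF _ X] measurable_id_vec)
    have g: "(\<lambda>b. ennreal (?g b)) \<in> borel_measurable (posterior (?\<mu> + z))"
      unfolding measurable_cong_sets[OF sets_posterior[OF y] refl] by measurable
    have "ennreal (\<integral>x. (hellinger (true_density \<sigma> \<beta> x) (predictive_density \<sigma> a c \<gamma> \<alpha> X (?\<mu> + z) x))\<^sup>2
      \<partial>measure_pmf (empirical_rows X)) \<le> (\<integral>\<^sup>+ b. ennreal (sqn (X *\<^sub>v b - ?\<mu>) / (4 * \<sigma>\<^sup>2 * real n)) \<partial>posterior (?\<mu> + z))"
      by (rule hellinger_risk_le[OF \<beta> y n])
    also have "\<dots> \<le> (\<integral>\<^sup>+ b. (ennreal (T / (4 * real n)) + ennreal ?K * ennreal (?g b)) \<partial>posterior (?\<mu> + z))"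
    proof (rule nn_integral_mono)
      fix b
      let ?q = "sqn (X *\<^sub>v b - ?\<mu>) / \<sigma>\<^sup>2"
      have "\<eta> * (?q - T) \<le> exp (\<eta> * (?q - T))"
        using exp_ge_add_one_self[of "\<eta> * (?q - T)"] by linarith
      also have "\<dots> = exp (- \<eta> * T) * ?g b"
        by (simp add: mult_exp_exp algebra_simps)
      finally have "?q \<le> T + exp (- \<eta> * T) * ?g b / \<eta>"
        using \<eta> by (simp add: field_simps)
      then have "?q / (4 * real n) \<le> (T + exp (- \<eta> * T) * ?g b / \<eta>) / (4 * real n)"
        by (rule divide_right_mono) simp
      also have "\<dots> = T / (4 * real n) + ?K * ?g b"
        using \<eta> n by (simp add: field_simps)
      finally have "sqn (X *\<^sub>v b - ?\<mu>) / (4 * \<sigma>\<^sup>2 * real n) \<le> T / (4 * real n) + ?K * ?g b"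
        by (simp add: mult_ac)
      then have "ennreal (sqn (X *\<^sub>v b - ?\<mu>) / (4 * \<sigma>\<^sup>2 * real n)) \<le> ennreal (T / (4 * real n) + ?K * ?g b)"
        by (rule ennreal_leI)
      also have "\<dots> = ennreal (T / (4 * real n)) + ennreal (?K * ?g b)"
        using T K by (intro ennreal_plus mult_nonneg_nonneg) auto
      also have "ennreal (?K * ?g b) = ennreal ?K * ennreal (?g b)"
        using K by (intro ennreal_mult) auto
      finally show "ennreal (sqn (X *\<^sub>v b - ?\<mu>) / (4 * \<sigma>\<^sup>2 * real n))
        \<le> ennreal (T / (4 * real n)) + ennreal ?K * ennreal (?g b)" .
    qed
    also have "\<dots> = ennreal (T / (4 * real n)) + ennreal ?K * (\<integral>\<^sup>+ b. ennreal (?g b) \<partial>posterior (?\<mu> + z))"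
      using g by (simp add: nn_integral_add nn_integral_cmult P.emeasure_space_1)
    also have "\<dots> \<le> ?U z"
      by (intro add_left_mono mult_left_mono posterior_exp_moment[OF \<beta> S0 z _ \<eta>']) (use \<eta> in auto)
    finally show ?thesis .
  qed
  have law: "data_law \<sigma> X \<beta> = mvn ?\<mu> (\<sigma>\<^sup>2 \<cdot>\<^sub>m 1\<^sub>m n)" using X by (simp add: data_law_def)
  have meas_E: "(\<lambda>z. ennreal (?w S * exp (excess \<eta> ?\<mu> S z))) \<in> borel_measurable (lborel_vec n)" if S: "S \<in> models X" for S
  proof -
    note [measurable] = measurable_excess[OF S \<mu>]
    show ?thesis by measurable
  qed
  \<comment> \<open>The majorant with the sum outside \<open>ennreal\<close>, so that integral and
    sum commute. Its measurability, also as a function of \<open>y\<close>, is needed for recentring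
    the data law.\<close>
  let ?V = "\<lambda>z. ennreal (T / (4 * real n)) + ennreal ?K * (\<Sum>S\<in>models X. ennreal (?w S * exp (excess \<eta> ?\<mu> S z)))"
  have UV: "?U = ?V"
    by (subst sum_ennreal) (auto intro!: mult_nonneg_nonneg w simp del: times_divide_eq_left)
  have meas_V: "?V \<in> borel_measurable (lborel_vec n)"
    using meas_E by (intro borel_measurable_add borel_measurable_const borel_measurable_times_ennreal borel_measurable_sum) auto
  have meas_Vy: "(\<lambda>y. ?V (y - ?\<mu>)) \<in> borel_measurable (lborel_vec n)"
    by (rule measurable_compose[OF measurable_minus_vec[OF measurable_id_vec measurable_const_vec[OF \<mu>]] meas_V])
  have "(\<integral>\<^sup>+ y. ennreal (\<integral>x. (hellinger (true_density \<sigma> \<beta> x) (predictive_density \<sigma> a c \<gamma> \<alpha> X y x))\<^sup>2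
      \<partial>measure_pmf (empirical_rows X)) \<partial>data_law \<sigma> X \<beta>) \<le> (\<integral>\<^sup>+ y. ?V (y - ?\<mu>) \<partial>mvn ?\<mu> (\<sigma>\<^sup>2 \<cdot>\<^sub>m 1\<^sub>m n))"
    unfolding law
  proof (rule nn_integral_mono)
    fix y assume "y \<in> space (mvn ?\<mu> (\<sigma>\<^sup>2 \<cdot>\<^sub>m 1\<^sub>m n))"
    then have y: "y \<in> carrier_vec n" by (simp add: N.space_mvn[OF \<mu>])
    have "?\<mu> + (y - ?\<mu>) = y" by (rule add_diff_cancel_vec[OF \<mu> y])
    then show "ennreal (\<integral>x. (hellinger (true_density \<sigma> \<beta> x) (predictive_density \<sigma> a c \<gamma> \<alpha> X y x))\<^sup>2
      \<partial>measure_pmf (empirical_rows X)) \<le> ?V (y - ?\<mu>)"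
      using pointwise[of "y - ?\<mu>"] y \<mu> unfolding UV[THEN fun_cong] by simp
  qed
  also have "\<dots> = (\<integral>\<^sup>+ z. ?V (?\<mu> + z - ?\<mu>) \<partial>?N)"
    by (rule N.nn_integral_mvn_centered[OF meas_Vy \<mu>])
  also have "\<dots> = (\<integral>\<^sup>+ z. ?V z \<partial>?N)"
  proof (rule nn_integral_cong)
    fix z assume "z \<in> space ?N"
    then have z: "z \<in> carrier_vec n" by (simp add: N.space_mvn)
    have "?\<mu> + z - ?\<mu> = z" by (rule add_diff_cancel_vec[OF \<mu> z])
    then show "?V (?\<mu> + z - ?\<mu>) = ?V z" by simp
  qed
  also have "\<dots> = ennreal (T / (4 * real n)) + ennreal ?K * (\<Sum>S\<in>models X. \<integral>\<^sup>+ z. ennreal (?w S * exp (excess \<eta> ?\<mu> S z)) \<partial>?N)"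
  proof -
    have m: "(\<lambda>z. ennreal (?w S * exp (excess \<eta> ?\<mu> S z))) \<in> borel_measurable ?N" if "S \<in> models X" for S
      unfolding N.measurable_mvn[OF zero_carrier_vec] by (rule meas_E[OF that])
    show ?thesis
      using m by (simp add: nn_integral_add nn_integral_cmult nn_integral_sum PN.emeasure_space_1
          borel_measurable_sum borel_measurable_times_ennreal)
  qed
  also have "\<dots> \<le> ennreal (T / (4 * real n)) + ennreal ?K * (\<Sum>S\<in>models X. ennreal (?w S * (1 - (\<alpha> + 4 * \<eta>)) powr (- real (card S) / 2)))"
  proof (intro add_left_mono mult_left_mono sum_mono)
    fix S assume S: "S \<in> models X"
    note [measurable] = measurable_excess[OF S \<mu>]
    have "(\<integral>\<^sup>+ z. ennreal (?w S * exp (excess \<eta> ?\<mu> S z)) \<partial>?N) = ennreal (?w S) * (\<integral>\<^sup>+ z. ennreal (exp (excess \<eta> ?\<mu> S z)) \<partial>?N)"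
      unfolding ennreal_mult[OF w[OF S] exp_ge_zero]
      by (rule nn_integral_cmult) (simp add: N.measurable_mvn)
    also have "\<dots> \<le> ennreal (?w S) * ennreal ((1 - (\<alpha> + 4 * \<eta>)) powr (- real (card S) / 2))"
      using \<eta> by (intro mult_left_mono expectation_excess[OF S \<mu>]) auto
    also have "\<dots> = ennreal (?w S * (1 - (\<alpha> + 4 * \<eta>)) powr (- real (card S) / 2))"
      by (rule ennreal_mult[OF w[OF S] powr_ge_zero, symmetric])
    finally show "(\<integral>\<^sup>+ z. ennreal (?w S * exp (excess \<eta> ?\<mu> S z)) \<partial>?N)
      \<le> ennreal (?w S * (1 - (\<alpha> + 4 * \<eta>)) powr (- real (card S) / 2))" .
  qed simp
  also have "\<dots> = ennreal (T / (4 * real n) + ?K * (\<Sum>S\<in>models X. ?w S * (1 - (\<alpha> + 4 * \<eta>)) powr (- real (card S) / 2)))"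
  proof -
    have nn: "?w S * (1 - (\<alpha> + 4 * \<eta>)) powr (- real (card S) / 2) \<ge> 0" if "S \<in> models X" for S
      by (intro mult_nonneg_nonneg w[OF that] powr_ge_zero)
    have 1: "0 \<le> (\<Sum>S\<in>models X. ?w S * (1 - (\<alpha> + 4 * \<eta>)) powr (- real (card S) / 2))"
      by (rule sum_nonneg) (rule nn)
    have 2: "0 \<le> T / (4 * real n)" using T by simp
    have 3: "(\<Sum>S\<in>models X. ennreal (?w S * (1 - (\<alpha> + 4 * \<eta>)) powr (- real (card S) / 2)))
        = ennreal (\<Sum>S\<in>models X. ?w S * (1 - (\<alpha> + 4 * \<eta>)) powr (- real (card S) / 2))"
      by (rule sum_ennreal) (rule nn)
    show ?thesis
      by (simp only: 3 ennreal_mult[OF K 1] ennreal_plus[OF 2 mult_nonneg_nonneg[OF K 1]])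
  qed
  also have "T / (4 * real n) + ?K * (\<Sum>S\<in>models X. ?w S * (1 - (\<alpha> + 4 * \<eta>)) powr (- real (card S) / 2))
    = 1 / (4 * real n) * (T + exp (- \<eta> * T) / \<eta> * (\<Sum>S\<in>models X. ?w S * (1 - (\<alpha> + 4 * \<eta>)) powr (- real (card S) / 2)))"
    by (simp only: distrib_left) simp
  finally show ?thesis .
qed

text \<open>The number of models of size \<open>k\<close> cancels the binomial coefficient in their prior weights.\<close>

lemma model_prior_sum_le:
  assumes S0: "S0 \<in> models X" and K: "K \<ge> 0" and ratio: "2 * K \<le> c * real p powr a"
  shows "(\<Sum>S\<in>models X. \<pi> S * K ^ card S) \<le> \<pi> S0 * (2 * (real p * (c * real p powr a)) ^ card S0)"
proof -
  let ?r = "c * real p powr a"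
  let ?Z = "\<Sum>l\<le>mat_rank X. inverse (?r ^ l)"
  have r: "?r > 0" using c p by simp
  have Z: "?Z > 0" using r by (intro sum_pos) auto
  have dim: "dim_col X = p" using X by simp
  have prior_eq: "\<pi> S = inverse (?r ^ card S) / ?Z / real (p choose card S)" for S
    by (simp add: model_prior_def size_prior_def dim)
  have s: "card S0 \<le> p" using card_mono[OF _ models_subset[OF S0]] by simp
  have "(\<Sum>S\<in>models X. \<pi> S * K ^ card S) = (\<Sum>k\<le>mat_rank X. \<Sum>S\<in>{S \<in> models X. card S = k}. \<pi> S * K ^ card S)"
    by (rule sum.group[symmetric, OF finite_models]) (auto simp: models_def)
  also have "\<dots> \<le> (\<Sum>k\<le>mat_rank X. (K / ?r) ^ k / ?Z)"
  proof (rule sum_mono)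
    fix k assume "k \<in> {..mat_rank X}"
    then have "{S \<in> models X. card S = k} = {S. S \<subseteq> {..<p} \<and> card S = k}"
      by (auto simp: models_def dim)
    then have card: "card {S \<in> models X. card S = k} = p choose k"
      using n_subsets[of "{..<p}" k] by simp
    have "(\<Sum>S\<in>{S \<in> models X. card S = k}. \<pi> S * K ^ card S)
        = (\<Sum>S\<in>{S \<in> models X. card S = k}. inverse (?r ^ k) / ?Z / real (p choose k) * K ^ k)"
      by (rule sum.cong) (auto simp: prior_eq)
    also have "\<dots> = real (p choose k) * (inverse (?r ^ k) / ?Z / real (p choose k) * K ^ k)"
      by (simp only: sum_constant card)
    \<comment> \<open>An inequality covers the degenerate case in which the binomial coefficient is
      0 and the left side vanishes.\<close>
    also have "\<dots> \<le> inverse (?r ^ k) / ?Z * K ^ k"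
      using K r Z by (cases "p choose k = 0") auto
    also have "\<dots> = (K / ?r) ^ k / ?Z"
      by (simp add: power_divide field_simps)
    finally show "(\<Sum>S\<in>{S \<in> models X. card S = k}. \<pi> S * K ^ card S) \<le> (K / ?r) ^ k / ?Z" .
  qed
  also have "\<dots> = (\<Sum>k\<le>mat_rank X. (K / ?r) ^ k) / ?Z" by (simp add: sum_divide_distrib)
  also have "\<dots> \<le> 2 / ?Z"
  proof (rule divide_right_mono)
    have "K / ?r \<le> 1 / 2" "0 \<le> K / ?r" using ratio r K by (auto simp: field_simps)
    then have "(\<Sum>k\<le>mat_rank X. (K / ?r) ^ k) \<le> (\<Sum>k\<le>mat_rank X. (1 / 2) ^ k)"
      by (intro sum_mono power_mono)
    also have "\<dots> \<le> (\<Sum>k. (1 / 2 :: real) ^ k)"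
      by (rule sum_le_suminf) auto
    also have "\<dots> = 2" by (simp add: suminf_geometric)
    finally show "(\<Sum>k\<le>mat_rank X. (K / ?r) ^ k) \<le> 2" .
  qed (use Z in simp)
  also have "\<dots> = \<pi> S0 * (2 * (real (p choose card S0) * ?r ^ card S0))"
    using s p c r Z by (simp add: prior_eq field_simps)
  \<comment> \<open>The crude bound on the binomial coefficient does not change the order of the
    logarithm for a > 0: the size penalty already contains p to the power a |S0|.\<close>
  also have "\<dots> \<le> \<pi> S0 * (2 * (real p * ?r) ^ card S0)"
  proof -
    have "(p choose card S0) \<le> p ^ card S0"
      using binomial_le_pow[OF s] by simp
    then have "real (p choose card S0) \<le> real p ^ card S0"
      by (metis of_nat_le_iff of_nat_power)
    then have "real (p choose card S0) * ?r ^ card S0 \<le> (real p * ?r) ^ card S0"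
      unfolding power_mult_distrib[of "real p"] using r by (intro mult_right_mono) auto
    then show ?thesis
      using model_prior_pos[OF S0] by (intro mult_left_mono) auto
  qed
  finally show ?thesis .
qed

text \<open>With \<open>\<eta> = \<alpha> (1 - \<alpha>) / 4\<close> one has \<open>1 - (\<alpha> + 4 \<eta>) = (1 - \<alpha>)\<^sup>2\<close>, and the truncation level is chosen so that
  the exponential remainder is constant.\<close>

lemma predictive_risk_log_bound:
  assumes \<beta>: "\<beta> \<in> carrier_vec p" and S0: "support_vec \<beta> \<in> models X" and n: "n > 0"
    and large: "2 / (1 - \<alpha>) \<le> c * real p powr a"
  shows "(\<integral>\<^sup>+ y. ennreal (\<integral>x. (hellinger (true_density \<sigma> \<beta> x) (predictive_density \<sigma> a c \<gamma> \<alpha> X y x))\<^sup>2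
      \<partial>measure_pmf (empirical_rows X)) \<partial>data_law \<sigma> X \<beta>)
    \<le> ennreal ((1 + ln 2 + real (card (support_vec \<beta>)) * ((1 + a) * ln (real p) + ln c + ln (1 + \<alpha> / \<gamma>) / 2))
        / (\<alpha> * (1 - \<alpha>) * real n))"
proof -
  let ?S0 = "support_vec \<beta>"
  let ?s = "card ?S0"
  let ?r = "c * real p powr a"
  define \<eta> where "\<eta> = \<alpha> * (1 - \<alpha>) / 4"
  \<comment> \<open>The value obtained for the weighted sum over models: 2 bounds the geometric
    series, the power of p r bounds the inverse prior weight of the true model up to normalisation,
    and \<open>shrink\<close> comes from its evidence.\<close>
  define A where "A = 2 * (real p * ?r) ^ ?s / shrink ?S0"
  have \<eta>: "\<eta> > 0" "4 * \<eta> \<le> \<alpha> * (1 - \<alpha>)" using \<alpha> by (auto simp: \<eta>_def)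
  have "2 \<le> 2 / (1 - \<alpha>)" using \<alpha> by (simp add: field_simps)
  then have r2: "?r \<ge> 2" using large by linarith
  have pr: "real p * ?r \<ge> 1"
    using mult_mono[of 1 "real p" 1 ?r] p r2 by simp
  have "(\<gamma> / (\<alpha> + \<gamma>)) powr (real ?s / 2) \<le> 1 powr (real ?s / 2)"
    using \<alpha> \<gamma> by (intro powr_mono2) auto
  then have sh: "shrink ?S0 \<le> 1" by (simp add: shrink_def)
  have "1 \<le> (real p * ?r) ^ ?s" using pr by (rule one_le_power)
  \<comment> \<open>This makes the truncation level T = ln A / \<eta> nonnegative; then exp (-
    \<eta> T) = 1 / A cancels the sum over models.\<close>
  then have A1: "A \<ge> 1"
    using sh shrink_pos[of ?S0] by (simp add: A_def field_simps)
  have powr_eq: "(1 - (\<alpha> + 4 * \<eta>)) powr (- real k / 2) = (1 / (1 - \<alpha>)) ^ k" for k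
  proof -
    have "4 * \<eta> = \<alpha> * (1 - \<alpha>)" by (simp add: \<eta>_def)
    then have "1 - (\<alpha> + 4 * \<eta>) = (1 - \<alpha>)\<^sup>2" by (simp add: power2_eq_square algebra_simps)
    then have "1 - (\<alpha> + 4 * \<eta>) = (1 - \<alpha>) powr 2" using \<alpha> by simp
    then have "(1 - (\<alpha> + 4 * \<eta>)) powr (- real k / 2) = (1 - \<alpha>) powr (- real k)"
      by (simp add: powr_powr)
    also have "\<dots> = (1 / (1 - \<alpha>)) ^ k"
      using \<alpha> by (simp add: powr_minus powr_realpow power_divide inverse_eq_divide)
    finally show ?thesis .
  qed
  have "(\<Sum>S\<in>models X. \<pi> S / (\<pi> ?S0 * shrink ?S0) * (1 - (\<alpha> + 4 * \<eta>)) powr (- real (card S) / 2))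
      = (\<Sum>S\<in>models X. \<pi> S * (1 / (1 - \<alpha>)) ^ card S) / (\<pi> ?S0 * shrink ?S0)"
    by (simp only: powr_eq sum_divide_distrib) simp
  also have "\<dots> \<le> \<pi> ?S0 * (2 * (real p * ?r) ^ ?s) / (\<pi> ?S0 * shrink ?S0)"
    using \<alpha> large model_prior_pos[OF S0] shrink_pos[of ?S0]
    by (intro divide_right_mono model_prior_sum_le[OF S0]) auto
  also have "\<dots> = A" using model_prior_pos[OF S0] by (simp add: A_def)
  finally have sum_le: "(\<Sum>S\<in>models X. \<pi> S / (\<pi> ?S0 * shrink ?S0) * (1 - (\<alpha> + 4 * \<eta>)) powr (- real (card S) / 2)) \<le> A" .
  have lnA: "ln A = ln 2 + real ?s * ((1 + a) * ln (real p) + ln c + ln (1 + \<alpha> / \<gamma>) / 2)"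
  proof -
    have "1 + \<alpha> / \<gamma> = inverse (\<gamma> / (\<alpha> + \<gamma>))" using \<alpha> \<gamma> by (simp add: field_simps)
    then have "ln (1 + \<alpha> / \<gamma>) = - ln (\<gamma> / (\<alpha> + \<gamma>))"
      using \<alpha> \<gamma> by (simp only: ln_inverse)
    then have "ln (shrink ?S0) = - (real ?s * ln (1 + \<alpha> / \<gamma>) / 2)"
      using \<alpha> \<gamma> by (simp add: shrink_def ln_powr)
    moreover have "ln ((real p * ?r) ^ ?s) = real ?s * (ln (real p) + (ln c + a * ln (real p)))"
      using p c by (simp add: ln_realpow ln_mult ln_powr)
    moreover have "ln A = ln 2 + ln ((real p * ?r) ^ ?s) - ln (shrink ?S0)"
      using pr shrink_pos[of ?S0] p c by (simp add: A_def ln_div ln_mult)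
    ultimately show ?thesis by (simp add: algebra_simps)
  qed
  have "(\<integral>\<^sup>+ y. ennreal (\<integral>x. (hellinger (true_density \<sigma> \<beta> x) (predictive_density \<sigma> a c \<gamma> \<alpha> X y x))\<^sup>2
      \<partial>measure_pmf (empirical_rows X)) \<partial>data_law \<sigma> X \<beta>)
    \<le> ennreal (1 / (4 * real n) * (ln A / \<eta> + exp (- \<eta> * (ln A / \<eta>)) / \<eta> *
        (\<Sum>S\<in>models X. \<pi> S / (\<pi> ?S0 * shrink ?S0) * (1 - (\<alpha> + 4 * \<eta>)) powr (- real (card S) / 2))))"
    using \<eta> A1 by (intro predictive_risk_le[OF \<beta> S0 n]) auto
  also have "\<dots> \<le> ennreal (1 / (4 * real n) * (ln A / \<eta> + exp (- \<eta> * (ln A / \<eta>)) / \<eta> * A))"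
    using \<eta> by (intro ennreal_leI mult_left_mono add_left_mono sum_le) auto
  also have "exp (- \<eta> * (ln A / \<eta>)) = 1 / A" using A1 \<eta> by (simp add: exp_minus inverse_eq_divide)
  also have "1 / (4 * real n) * (ln A / \<eta> + 1 / A / \<eta> * A) = (1 + ln A) / (4 * \<eta> * real n)"
    using A1 by (simp add: add_divide_distrib mult_ac distrib_left)
  also have "4 * \<eta> = \<alpha> * (1 - \<alpha>)" by (simp add: \<eta>_def)
  finally show ?thesis by (simp only: lnA add.assoc)
qed

end

text \<open>The finite-sample bound is of order s ln p, since the prior charges a ln p for every
  coordinate whatever the sparsity. \<open>log_order\<close> converts this to s ln (p / s); it means
  that eventually s is at most p to the power 1 - 1 / M for a constant M. The supremum lies under
  one constant, so the bound is uniform over the sparse vectors, and finiteness of the risk is part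
  of the conclusion.\<close>

theorem corollary1:
  fixes p s :: "nat \<Rightarrow> nat" and X :: "nat \<Rightarrow> real Matrix.mat"
    and \<sigma> a c \<gamma> \<alpha> :: real
  assumes "\<sigma> > 0" and "a > 0" and "c > 0" and "\<gamma> > 0" and "0 < \<alpha>" and "\<alpha> < 1"
    and dims: "\<And>n. n \<ge> 1 \<Longrightarrow> n \<le> p n"
    and design: "\<And>n. n \<ge> 1 \<Longrightarrow> X n \<in> carrier_mat n (p n)"
    and full_rank: "\<And>n. n \<ge> 1 \<Longrightarrow> mat_rank (X n) = n"
    and gram_invertible:
      "\<And>n S. n \<ge> 1 \<Longrightarrow> S \<in> models (X n) \<Longrightarrow> invertible_mat (gram_mat (X n) S)"
    and sparsity: "\<And>n. n \<ge> 1 \<Longrightarrow> 1 \<le> s n \<and> s n \<le> p n"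
    and small: "(\<lambda>n. real (s n) * ln (real (p n) / real (s n))) \<in> o(\<lambda>n. real n)"
    and log_order: "(\<lambda>n. ln (real (p n))) \<in> O(\<lambda>n. ln (real (p n) / real (s n)))"
  shows "\<exists>C>0. \<forall>\<^sub>F n in sequentially.
    (SUP \<beta>\<in>{\<beta> \<in> carrier_vec (p n). card (support_vec \<beta>) = s n}.
       \<integral>\<^sup>+ y. ennreal (\<integral>x. (hellinger (true_density \<sigma> \<beta> x)
                              (predictive_density \<sigma> a c \<gamma> \<alpha> (X n) y x))\<^sup>2
                    \<partial>measure_pmf (empirical_rows (X n)))
         \<partial>data_law \<sigma> (X n) \<beta>)
      \<le> ennreal (C * rate_sq p s n)"
proof -
  \<comment> \<open>Majorises the part of the cost per coordinate that does not grow with p; it is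
    absorbed into B ln p once ln p \<ge> 1.\<close>
  define B where "B = \<bar>ln c\<bar> + ln (1 + \<alpha> / \<gamma>) / 2"
  have B: "B \<ge> 0" using assms by (simp add: B_def)
  obtain M where M: "M > 0"
    and log_le: "\<forall>\<^sub>F n in sequentially. norm (ln (real (p n))) \<le> M * norm (ln (real (p n) / real (s n)))"
    using landau_o.bigE[OF log_order] by blast
  \<comment> \<open>3 + a + B collects 2 from the additive 1 + ln 2 and 1 + a + B from the cost per
    coordinate; M is the price of passing from ln p to ln (p / s).\<close>
  define C where "C = M * (3 + a + B) / (\<alpha> * (1 - \<alpha>))"
  have C: "C > 0" using assms M B by (simp add: C_def)
  \<comment> \<open>The tolerance 1 / M is chosen so that s \<le> s ln p \<le> M s ln (p / s) \<le>
    n.\<close>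
  have ev_small: "\<forall>\<^sub>F n in sequentially.
      norm (real (s n) * ln (real (p n) / real (s n))) \<le> 1 / M * norm (real n)"
    using M by (intro landau_o.smallD[OF small]) simp
  \<comment> \<open>As p \<ge> n, growth in n forces c p^a past 2 / (1 - \<alpha>), which makes the
    ratio of the geometric series over model sizes at most 1 / 2.\<close>
  have "filterlim (\<lambda>n. c * real n powr a) at_top sequentially"
    using \<open>a > 0\<close> \<open>c > 0\<close> by real_asymp
  then have ev_ratio: "\<forall>\<^sub>F n in sequentially. 2 / (1 - \<alpha>) \<le> c * real n powr a"
    by (simp add: filterlim_at_top)
  have "filterlim (\<lambda>n. ln (real n)) at_top sequentially" by real_asymp
  then have ev_ln: "\<forall>\<^sub>F n in sequentially. 1 \<le> ln (real n)"
    by (simp add: filterlim_at_top)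
  have "\<forall>\<^sub>F n in sequentially.
    (SUP \<beta>\<in>{\<beta> \<in> carrier_vec (p n). card (support_vec \<beta>) = s n}.
       \<integral>\<^sup>+ y. ennreal (\<integral>x. (hellinger (true_density \<sigma> \<beta> x)
                              (predictive_density \<sigma> a c \<gamma> \<alpha> (X n) y x))\<^sup>2
                    \<partial>measure_pmf (empirical_rows (X n)))
         \<partial>data_law \<sigma> (X n) \<beta>)
      \<le> ennreal (C * rate_sq p s n)"
    using log_le ev_small ev_ratio ev_ln eventually_ge_at_top[of 1]
  proof eventually_elim
    case (elim n)
    have n: "n \<ge> 1" "real n > 0" using elim(5) by auto
    have np: "n \<le> p n" and p: "p n > 0" using dims[OF n(1)] n(1) by auto
    have s: "1 \<le> s n" "s n \<le> p n" using sparsity[OF n(1)] by auto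
    have "ln (real n) \<le> ln (real (p n))" using np n by simp
    then have lnp: "ln (real (p n)) \<ge> 1" using elim(4) by linarith
    have lnps: "ln (real (p n) / real (s n)) \<ge> 0" using s by simp
    have log: "ln (real (p n)) \<le> M * ln (real (p n) / real (s n))"
      using elim(1) lnp lnps by simp
    have "real (s n) * 1 \<le> real (s n) * (M * ln (real (p n) / real (s n)))"
      using lnp log by (intro mult_left_mono) auto
    also have "\<dots> = M * (real (s n) * ln (real (p n) / real (s n)))" by simp
    also have "\<dots> \<le> M * (1 / M * real n)"
      using elim(2) lnps M by (intro mult_left_mono) auto
    also have "\<dots> = real n" using M by simp
    finally have sn: "s n \<le> n" by simp
    interpret eb_regression n "p n" "X n" \<sigma> a c \<gamma> \<alpha>
      using assms(1-6) p design[OF n(1)] gram_invertible[OF n(1)] by unfold_locales auto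
    have "real n powr a \<le> real (p n) powr a"
      using np \<open>a > 0\<close> by (intro powr_mono2) auto
    then have "c * real n powr a \<le> c * real (p n) powr a"
      using \<open>c > 0\<close> by simp
    then have large: "2 / (1 - \<alpha>) \<le> c * real (p n) powr a" using elim(3) by linarith
    have bound: "(1 + ln 2 + real (s n) * ((1 + a) * ln (real (p n)) + ln c + ln (1 + \<alpha> / \<gamma>) / 2))
        / (\<alpha> * (1 - \<alpha>) * real n) \<le> C * rate_sq p s n"
    proof -
      let ?L = "ln (real (p n))"
      have "ln c + ln (1 + \<alpha> / \<gamma>) / 2 \<le> B * 1" by (simp add: B_def)
      also have "\<dots> \<le> B * ?L" using lnp B by (intro mult_left_mono)
      finally have "(1 + a) * ?L + ln c + ln (1 + \<alpha> / \<gamma>) / 2 \<le> (1 + a + B) * ?L"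
        by (simp add: algebra_simps)
      then have 1: "real (s n) * ((1 + a) * ?L + ln c + ln (1 + \<alpha> / \<gamma>) / 2) \<le> real (s n) * ((1 + a + B) * ?L)"
        by (rule mult_left_mono) simp
      \<comment> \<open>Since s \<ge> 1 and ln p \<ge> 1, the additive constants are themselves of
        order s ln p.\<close>
      have "1 * 1 \<le> real (s n) * ?L" using s lnp by (intro mult_mono) auto
      moreover have "ln 2 \<le> (1 :: real)" using ln_le_minus_one[of "2 :: real"] by simp
      ultimately have 2: "1 + ln 2 \<le> 2 * (real (s n) * ?L)" by linarith
      have "1 + ln 2 + real (s n) * ((1 + a) * ?L + ln c + ln (1 + \<alpha> / \<gamma>) / 2)
          \<le> 2 * (real (s n) * ?L) + real (s n) * ((1 + a + B) * ?L)"
        by (rule add_mono[OF 2 1])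
      also have "\<dots> = (3 + a + B) * real (s n) * ?L" by (simp add: algebra_simps)
      also have "\<dots> \<le> (3 + a + B) * real (s n) * (M * ln (real (p n) / real (s n)))"
        using B \<open>a > 0\<close> by (intro mult_left_mono[OF log]) auto
      finally have "(1 + ln 2 + real (s n) * ((1 + a) * ?L + ln c + ln (1 + \<alpha> / \<gamma>) / 2)) / (\<alpha> * (1 - \<alpha>) * real n)
        \<le> ((3 + a + B) * real (s n) * (M * ln (real (p n) / real (s n)))) / (\<alpha> * (1 - \<alpha>) * real n)"
        using assms n by (intro divide_right_mono) auto
      also have "\<dots> = C * rate_sq p s n" by (simp add: C_def rate_sq_def)
      finally show ?thesis .
    qed
    show ?case
    proof (rule SUP_least)
      fix \<beta> :: "real Matrix.vec"
      assume "\<beta> \<in> {\<beta> \<in> carrier_vec (p n). card (support_vec \<beta>) = s n}"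
      then have \<beta>: "\<beta> \<in> carrier_vec (p n)" and card: "card (support_vec \<beta>) = s n" by auto
      have "dim_col (X n) = p n" using X by simp
      \<comment> \<open>s \<le> n and the full rank n place the true support among the models
        charged by the prior, as the lower bound on the evidence requires.\<close>
      then have "support_vec \<beta> \<in> models (X n)"
        using \<beta> card sn full_rank[OF n(1)] by (auto simp: models_def support_vec_def)
      from predictive_risk_log_bound[OF \<beta> this _ large] n
      show "(\<integral>\<^sup>+ y. ennreal (\<integral>x. (hellinger (true_density \<sigma> \<beta> x)
                              (predictive_density \<sigma> a c \<gamma> \<alpha> (X n) y x))\<^sup>2
                    \<partial>measure_pmf (empirical_rows (X n)))
         \<partial>data_law \<sigma> (X n) \<beta>) \<le> ennreal (C * rate_sq p s n)"
        unfolding card using ennreal_leI[OF bound] by (auto intro: order_trans)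
    qed
  qed
  with C show ?thesis by blast
qed

end
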